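(* Let $n>2$ be an integer, $2^*=2n/(n-2)$ and $d\mu(r)=r^{n-1}dr$ on $\mathbb{R}^+=(0,\infty)$. There exists a positive constant $C$ depending only on $n$ such that, for every $R>1$ and every $f$ with $f,Lf\in L^2(\mathbb{R}^n)$, where $L=\mathbf{x}\cdot\nabla$, and with $f$ supported in the annulus $A(1/R,R)=\{\mathbf{x}\in\mathbb{R}^n:1/R\le|\mathbf{x}|\le R\}$, $$\|r\mathcal{M}(f)(r)\|^2_{L^{2^*}(\mathbb{R}^+;d\mu)}\le C(\ln R)^{\frac{2(n-1)}{n}}\left\{\|Lf\|^2_{L^2(\mathbb{R}^n)}-\frac{n^2}{4}\|f\|^2_{L^2(\mathbb{R}^n)}\right\}.$$
   Context: $(\mathbf{x}\cdot\nabla)f=\sum_{j=1}^n x_j\,\partial f/\partial x_j$ in the sense of distributions. $\mathcal{M}(f)(r)=\frac{1}{|\mathbb{S}^{n-1}|}\int_{\mathbb{S}^{n-1}}f(r\omega)\,d\omega$ is the integral mean of $f$ over the unit sphere, and $\|H\|_{L^{2^*}(\mathbb{R}^+;d\mu)}=\big(\int_0^\infty|H(r)|^{2^*}r^{n-1}dr\big)^{1/2^*}$. *)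

theory Defs
  imports "HOL-Analysis.Analysis"
begin

section \<open>Lebesgue spaces\<close>

definition in_Lp :: "real \<Rightarrow> 'a measure \<Rightarrow> ('a \<Rightarrow> complex) \<Rightarrow> bool" where
  "in_Lp p M f \<longleftrightarrow> f \<in> borel_measurable M \<and> integrable M (\<lambda>x. norm (f x) powr p)"

text \<open>Meaningful only together with \<^term>\<open>in_Lp p M f\<close>: the Bochner integral of a
  non-integrable function is \<open>0\<close>.\<close>

definition Lp_norm :: "real \<Rightarrow> 'a measure \<Rightarrow> ('a \<Rightarrow> complex) \<Rightarrow> real" where
  "Lp_norm p M f = (\<integral>x. norm (f x) powr p \<partial>M) powr (1 / p)"

definition radial_measure :: "nat \<Rightarrow> real measure" where
  "radial_measure n = density (restrict_space lebesgue {0<..}) (\<lambda>r. ennreal (r ^ (n - 1)))"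

definition sobolev_exponent :: "nat \<Rightarrow> real" where
  "sobolev_exponent n = 2 * real n / (real n - 2)"

section \<open>Test functions and distributions\<close>

definition partial_deriv :: "'n \<Rightarrow> (real^'n::finite \<Rightarrow> complex) \<Rightarrow> real^'n \<Rightarrow> complex" where
  "partial_deriv j \<phi> x = frechet_derivative \<phi> (at x) (axis j 1)"

text \<open>A function is \<open>C\<^sup>\<infinity>\<close> iff all its iterated partial derivatives (including the function
  itself) are differentiable everywhere; continuity of the derivatives is then automatic.\<close>

definition test_function :: "(real^'n::finite \<Rightarrow> complex) \<Rightarrow> bool" where
  "test_function \<phi> \<longleftrightarrow>
     (\<forall>js. foldr partial_deriv js \<phi> differentiable_on UNIV) \<and> compact (closure {x. \<phi> x \<noteq> 0})"

text \<open>Distributions are represented by functionals of which only the values on test functions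
  are relevant.\<close>

type_synonym 'n distribution = "(real^'n \<Rightarrow> complex) \<Rightarrow> complex"

definition regular_dist :: "(real^'n::finite \<Rightarrow> complex) \<Rightarrow> 'n distribution" where
  "regular_dist f \<phi> = (\<integral>x. f x * \<phi> x \<partial>lebesgue)"

definition dist_partial :: "'n \<Rightarrow> 'n::finite distribution \<Rightarrow> 'n distribution" where
  "dist_partial j T \<phi> = - T (partial_deriv j \<phi>)"

definition dist_mult :: "(real^'n::finite \<Rightarrow> complex) \<Rightarrow> 'n distribution \<Rightarrow> 'n distribution" where
  "dist_mult a T \<phi> = T (\<lambda>x. a x * \<phi> x)"

definition dist_L :: "'n::finite distribution \<Rightarrow> 'n distribution" where
  "dist_L T \<phi> = (\<Sum>j\<in>UNIV. dist_mult (\<lambda>x. complex_of_real (x $ j)) (dist_partial j T) \<phi>)"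

text \<open>The function \<open>g\<close> is a version of \<open>(x \<cdot> \<nabla>) f\<close>. Among locally integrable functions,
  \<open>g\<close> is unique up to null sets.\<close>

definition is_Lf :: "(real^'n::finite \<Rightarrow> complex) \<Rightarrow> (real^'n \<Rightarrow> complex) \<Rightarrow> bool" where
  "is_Lf f g \<longleftrightarrow>
     (\<forall>\<phi>. test_function \<phi> \<longrightarrow> dist_L (regular_dist f) \<phi> = regular_dist g \<phi>)"

section \<open>Spherical means\<close>

text \<open>Surface measure on the unit sphere: the measure of a Borel set \<open>A\<close> is \<open>n\<close> times the
  Lebesgue measure of the cone \<open>{t\<omega> | 0 < t < 1, \<omega> \<in> A}\<close>, which is what
  \<open>dx = r\<^sup>n\<^sup>-\<^sup>1 dr d\<omega>\<close> amounts to. It is completed because for a Lebesgue measurable \<open>f\<close> the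
  function \<open>\<omega> \<mapsto> f (r\<omega>)\<close> is in general measurable (for almost every \<open>r\<close>) only with respect
  to the completed sigma-algebra.\<close>

definition sphere_measure :: "(real^'n::finite) measure" where
  "sphere_measure = completion (scale_measure (of_nat CARD('n))
     (distr (restrict_space lborel (ball 0 1 - {0})) (restrict_space borel (sphere 0 1))
        (\<lambda>x. x /\<^sub>R norm x)))"

definition spherical_mean :: "(real^'n::finite \<Rightarrow> complex) \<Rightarrow> real \<Rightarrow> complex" where
  "spherical_mean f r =
     (\<integral>\<omega>. f (r *\<^sub>R \<omega>) \<partial>sphere_measure) /\<^sub>R measure sphere_measure (sphere 0 1 :: (real^'n) set)"

lemma space_sphere_measure: "space (sphere_measure :: (real^'n::finite) measure) = sphere 0 1"
  by (simp add: sphere_measure_def space_restrict_space space_scale_measure)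

lemma normalize_measurable:
  "(\<lambda>x. x /\<^sub>R norm x) \<in>
     restrict_space lborel (ball 0 1 - {0}) \<rightarrow>\<^sub>M restrict_space borel (sphere 0 1 :: (real^'n::finite) set)"
proof (rule measurable_restrict_space2)
  show "(\<lambda>x. x /\<^sub>R norm x) \<in> space (restrict_space lborel (ball 0 1 - {0})) \<rightarrow> (sphere 0 1 :: (real^'n) set)"
    by (auto simp: space_restrict_space)
  have "(\<lambda>x::real^'n. x /\<^sub>R norm x) \<in> borel_measurable borel" by measurable
  then show "(\<lambda>x::real^'n. x /\<^sub>R norm x) \<in> borel_measurable (restrict_space lborel (ball 0 1 - {0}))"
    by (intro measurable_restrict_space1) simp
qed

lemma emeasure_sphere_measure:
  assumes "A \<in> sets borel" "A \<subseteq> (sphere 0 1 :: (real^'n::finite) set)"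
  shows "emeasure sphere_measure A =
    of_nat CARD('n) * emeasure lborel {x. x \<noteq> 0 \<and> norm x < 1 \<and> x /\<^sub>R norm x \<in> A}"
proof -
  let ?D = "distr (restrict_space lborel (ball 0 1 - {0})) (restrict_space borel (sphere 0 1))
        (\<lambda>x::real^'n. x /\<^sub>R norm x)"
  have A: "A \<in> sets (restrict_space borel (sphere 0 1))"
    using assms by (auto simp: sets_restrict_space)
  have "emeasure sphere_measure A = of_nat CARD('n) * emeasure ?D A"
    unfolding sphere_measure_def using A by (subst emeasure_completion) auto
  also have "emeasure ?D A = emeasure lborel {x. x \<noteq> 0 \<and> norm x < 1 \<and> x /\<^sub>R norm x \<in> A}"
    using A by (subst emeasure_distr[OF normalize_measurable])
      (auto simp: emeasure_restrict_space space_restrict_space intro!: arg_cong[where f="emeasure lborel"])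
  finally show ?thesis .
qed

end

theory Submission
  imports Defs
begin

text \<open>
  Write \<open>n\<close> for the dimension, \<open>S\<close> for the area of the unit sphere and \<open>a = ln R\<close>. The dilations
  \<open>(D\<^sub>s f)(x) = exp (n s / 2) f (exp s x)\<close> form a unitary group on the square integrable functions,
  and the derivative of \<open>D\<^sub>s f\<close> at \<open>s = 0\<close> is \<open>w = L f + (n / 2) f\<close>. Since the generator of a
  unitary group is skew, \<open>Re \<langle>w, f\<rangle> = 0\<close>; expanding \<open>L f = w - (n / 2) f\<close> gives
  \<open>\<parallel>w\<parallel>\<^sup>2 = \<parallel>L f\<parallel>\<^sup>2 - (n\<^sup>2 / 4) \<parallel>f\<parallel>\<^sup>2\<close>, so the bracket on the right hand side of the theorem is \<open>\<parallel>w\<parallel>\<^sup>2\<close>.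

  In the variable \<open>t = ln r\<close> put \<open>G(t) = exp (n t / 2) M(f)(exp t)\<close>. The exponent \<open>p = 2n / (n - 2)\<close>
  satisfies \<open>p (1 - n / 2) = - n\<close>, so the left hand side is the squared \<open>L\<^sup>p(dt)\<close> norm of \<open>G\<close>. The function
  \<open>G\<close> vanishes outside \<open>[- a, a]\<close>, and formally \<open>G'(t) = exp (n t / 2) M(w)(exp t)\<close>. By Cauchy-Schwarz
  \<open>\<bar>G\<bar>\<^sup>2 \<le> 2 a \<parallel>w\<parallel>\<^sup>2 / S\<close>, whence
  \<open>\<parallel>G\<parallel>\<^sub>p\<^sup>2 \<le> (2 a) powr (2 / p) * 2 a \<parallel>w\<parallel>\<^sup>2 / S\<close>, and \<open>2 / p + 1 = 2 (n - 1) / n\<close>. The constant is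
  therefore \<open>C = 2 powr (2 (n - 1) / n) / S\<close>.

  The distributional derivative enters only through the increments of the orbit \<open>s \<mapsto> D\<^sub>s f\<close>. Testing against a
  test function and moving the dilation to it gives a differentiable function of \<open>s\<close>, and the mean value theorem
  together with the density of test functions gives \<open>\<parallel>D\<^sub>s f - f\<parallel> \<le> \<bar>s\<bar> \<parallel>w\<parallel>\<close>
  (\<open>dil_increment_bound\<close>). This one estimate is used twice. First, with
  \<open>\<parallel>D\<^sub>s f - f\<parallel>\<^sup>2 = 2 \<parallel>f\<parallel>\<^sup>2 - 2 Re \<langle>D\<^sub>s f, f\<rangle>\<close> it shows that \<open>Re \<langle>D\<^sub>s f - f, f\<rangle>\<close> is of second order in
  \<open>s\<close>, which is the skewness (\<open>generator_skew\<close>, \<open>l2_generator_square\<close>). Secondly, it replaces \<open>G'\<close>: the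
  integral of \<open>\<bar>x\<bar>\<^bsup>-n/2\<^esup> f\<close> over the ball of radius \<open>\<rho>\<close> is the primitive of \<open>S G\<close> at \<open>ln \<rho>\<close>, a dilation of the
  radius is a dilation of \<open>f\<close>, and so the increments of this primitive are bounded by Cauchy-Schwarz
  (\<open>ball_integral_increment\<close>). Polar coordinates (\<open>polar_coordinates\<close>) and Lebesgue's differentiation
  theorem turn the bound for the increments into the pointwise bound for the spherical mean
  (\<open>radial_density_bound\<close>, \<open>sphere_integral_bound\<close>).
\<close>

section \<open>The Hilbert space of square integrable functions\<close>

definition sq_int :: "('a::euclidean_space \<Rightarrow> complex) \<Rightarrow> bool" where
  "sq_int u \<longleftrightarrow> u \<in> borel_measurable borel \<and> integrable lborel (\<lambda>x. (norm (u x))\<^sup>2)"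

definition l2 :: "('a::euclidean_space \<Rightarrow> complex) \<Rightarrow> real" where
  "l2 u = sqrt (\<integral>x. (norm (u x))\<^sup>2 \<partial>lborel)"

lemma sq_int_measurable: "sq_int u \<Longrightarrow> u \<in> borel_measurable borel"
  by (simp add: sq_int_def)

lemma l2_nonneg [simp]: "0 \<le> l2 u"
  by (simp add: l2_def)

lemma l2_square: "(l2 u)\<^sup>2 = (\<integral>x. (norm (u x))\<^sup>2 \<partial>lborel)"
  by (simp add: l2_def)

lemma sq_int_bound:
  assumes "sq_int u" "v \<in> borel_measurable borel" "\<And>x. norm (v x) \<le> norm (u x)"
  shows "sq_int v"
  unfolding sq_int_def
proof
  show "integrable lborel (\<lambda>x. (norm (v x))\<^sup>2)"
    by (rule Bochner_Integration.integrable_bound[of _ "\<lambda>x. (norm (u x))\<^sup>2"])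
       (use assms in \<open>auto simp: sq_int_def power_mono\<close>)
qed (use assms in auto)

lemma sq_int_cmult:
  assumes "sq_int u" shows "sq_int (\<lambda>x. c * u x)"
  using assms by (auto simp: sq_int_def norm_mult power_mult_distrib)

lemma sq_int_add:
  assumes "sq_int u" "sq_int v" shows "sq_int (\<lambda>x. u x + v x)"
  unfolding sq_int_def
proof
  have [measurable]: "u \<in> borel_measurable borel" "v \<in> borel_measurable borel"
    using assms by (auto simp: sq_int_def)
  show "(\<lambda>x. u x + v x) \<in> borel_measurable borel" by measurable
  show "integrable lborel (\<lambda>x. (norm (u x + v x))\<^sup>2)"
  proof (rule Bochner_Integration.integrable_bound)
    show "integrable lborel (\<lambda>x. 2 * (norm (u x))\<^sup>2 + 2 * (norm (v x))\<^sup>2)"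
      using assms by (auto simp: sq_int_def)
    have "(norm (u x + v x))\<^sup>2 \<le> 2 * (norm (u x))\<^sup>2 + 2 * (norm (v x))\<^sup>2" for x
    proof -
      have "(norm (u x + v x))\<^sup>2 \<le> (norm (u x) + norm (v x))\<^sup>2"
        by (intro power_mono norm_triangle_ineq) auto
      also have "\<dots> \<le> 2 * (norm (u x))\<^sup>2 + 2 * (norm (v x))\<^sup>2"
        using sum_squares_bound[of "norm (u x)" "norm (v x)"] by (simp add: power2_sum)
      finally show ?thesis .
    qed
    then show "AE x in lborel. norm ((norm (u x + v x))\<^sup>2)
        \<le> norm (2 * (norm (u x))\<^sup>2 + 2 * (norm (v x))\<^sup>2)"
      by (intro AE_I2) auto
  qed measurable
qed

lemma sq_int_diff:
  assumes "sq_int u" "sq_int v" shows "sq_int (\<lambda>x. u x - v x)"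
  using sq_int_add[OF assms(1) sq_int_cmult[OF assms(2), of "-1"]] by simp

lemma sq_int_cnj:
  assumes "sq_int u" shows "sq_int (\<lambda>x. cnj (u x))"
proof -
  have "cnj \<in> borel_measurable borel"
    by (rule borel_measurable_continuous_onI[OF linear_continuous_on[OF bounded_linear_cnj]])
  from measurable_compose[OF sq_int_measurable[OF assms] this] assms
  show ?thesis by (simp add: sq_int_def)
qed

lemma l2_cnj [simp]: "l2 (\<lambda>x. cnj (u x)) = l2 u"
  by (simp add: l2_def)

lemma Cauchy_Schwarz_norm:
  assumes "sq_int u" "sq_int v"
  shows "integrable lborel (\<lambda>x. norm (u x) * norm (v x))"
    and "(\<integral>x. norm (u x) * norm (v x) \<partial>lborel) \<le> l2 u * l2 v"
proof -
  have [measurable]: "u \<in> borel_measurable borel" "v \<in> borel_measurable borel"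
    using assms by (auto simp: sq_int_def)
  show int: "integrable lborel (\<lambda>x. norm (u x) * norm (v x))"
  proof (rule Bochner_Integration.integrable_bound)
    show "integrable lborel (\<lambda>x. (norm (u x))\<^sup>2 + (norm (v x))\<^sup>2)"
      using assms by (auto simp: sq_int_def)
    have "norm (u x) * norm (v x) \<le> (norm (u x))\<^sup>2 + (norm (v x))\<^sup>2" for x
      using sum_squares_bound[of "norm (u x)" "norm (v x)"]
        mult_nonneg_nonneg[OF norm_ge_zero[of "u x"] norm_ge_zero[of "v x"]]
      by linarith
    then show "AE x in lborel. norm (norm (u x) * norm (v x))
        \<le> norm ((norm (u x))\<^sup>2 + (norm (v x))\<^sup>2)"
      by (intro AE_I2) auto
  qed measurable
  have "(\<integral>\<^sup>+x. ennreal (norm (u x)) * ennreal (norm (v x)) \<partial>lborel)\<^sup>2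
      \<le> (\<integral>\<^sup>+x. (ennreal (norm (u x)))\<^sup>2 \<partial>lborel) * (\<integral>\<^sup>+x. (ennreal (norm (v x)))\<^sup>2 \<partial>lborel)"
    by (rule Cauchy_Schwarz_nn_integral) auto
  also have "(\<integral>\<^sup>+x. ennreal (norm (u x)) * ennreal (norm (v x)) \<partial>lborel)
     = ennreal (\<integral>x. norm (u x) * norm (v x) \<partial>lborel)"
    by (subst nn_integral_eq_integral[symmetric, OF int]) (auto simp: ennreal_mult)
  also have "(\<integral>\<^sup>+x. (ennreal (norm (u x)))\<^sup>2 \<partial>lborel) = ennreal ((l2 u)\<^sup>2)"
    unfolding l2_square using assms(1)
    by (subst nn_integral_eq_integral[symmetric]) (auto simp: sq_int_def ennreal_power)
  also have "(\<integral>\<^sup>+x. (ennreal (norm (v x)))\<^sup>2 \<partial>lborel) = ennreal ((l2 v)\<^sup>2)"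
    unfolding l2_square using assms(2)
    by (subst nn_integral_eq_integral[symmetric]) (auto simp: sq_int_def ennreal_power)
  finally have "(\<integral>x. norm (u x) * norm (v x) \<partial>lborel)\<^sup>2 \<le> (l2 u)\<^sup>2 * (l2 v)\<^sup>2"
    by (simp add: ennreal_power ennreal_mult[symmetric])
  then show "(\<integral>x. norm (u x) * norm (v x) \<partial>lborel) \<le> l2 u * l2 v"
    unfolding power_mult_distrib[symmetric] by (rule power2_le_imp_le) simp
qed

text \<open>The pairing is bilinear rather than sesquilinear, because test functions enter distributions without
  conjugation.\<close>

lemma Cauchy_Schwarz_integral:
  assumes "sq_int u" "sq_int v"
  shows "integrable lborel (\<lambda>x. u x * v x)"
    and "norm (\<integral>x. u x * v x \<partial>lborel) \<le> l2 u * l2 v"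
proof -
  have [measurable]: "u \<in> borel_measurable borel" "v \<in> borel_measurable borel"
    using assms by (auto simp: sq_int_def)
  show "integrable lborel (\<lambda>x. u x * v x)"
    by (rule Bochner_Integration.integrable_bound[OF Cauchy_Schwarz_norm(1)[OF assms]])
       (auto simp: norm_mult)
  have "norm (\<integral>x. u x * v x \<partial>lborel) \<le> (\<integral>x. norm (u x * v x) \<partial>lborel)"
    by (rule integral_norm_bound)
  then show "norm (\<integral>x. u x * v x \<partial>lborel) \<le> l2 u * l2 v"
    using Cauchy_Schwarz_norm(2)[OF assms] by (simp add: norm_mult)
qed

text \<open>The polarisation identity behind both the skewness of the generator and the norm identity
  for \<open>L f\<close>.\<close>

lemma l2_square_add:
  assumes "sq_int u" "sq_int v"
  shows "(l2 (\<lambda>x. u x + v x))\<^sup>2 = (l2 u)\<^sup>2 + 2 * Re (\<integral>x. u x * cnj (v x) \<partial>lborel) + (l2 v)\<^sup>2"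
proof -
  have i: "integrable lborel (\<lambda>x. u x * cnj (v x))"
    by (intro Cauchy_Schwarz_integral sq_int_cnj assms)
  have eq: "(norm (a + b))\<^sup>2 = (norm a)\<^sup>2 + 2 * Re (a * cnj b) + (norm b)\<^sup>2" for a b :: complex
    unfolding cmod_power2 by (simp add: power2_eq_square algebra_simps)
  show ?thesis
    unfolding l2_square eq integral_Re[OF i, symmetric] using assms integrable_Re[OF i]
    by (simp add: sq_int_def del: complex_mult_cnj times_complex.sel integral_Re)
qed

lemma l2_triangle:
  assumes "sq_int u" "sq_int v" shows "l2 (\<lambda>x. u x + v x) \<le> l2 u + l2 v"
proof (rule power2_le_imp_le)
  have "Re (\<integral>x. u x * cnj (v x) \<partial>lborel) \<le> norm (\<integral>x. u x * cnj (v x) \<partial>lborel)"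
    by (rule complex_Re_le_cmod)
  also have "\<dots> \<le> l2 u * l2 v"
    using Cauchy_Schwarz_integral(2)[OF assms(1) sq_int_cnj[OF assms(2)]] by simp
  finally show "(l2 (\<lambda>x. u x + v x))\<^sup>2 \<le> (l2 u + l2 v)\<^sup>2"
    unfolding l2_square_add[OF assms] power2_sum by simp
qed auto

lemma l2_cmult: "l2 (\<lambda>x. c * u x) = norm c * l2 u"
  by (simp add: l2_def norm_mult power_mult_distrib real_sqrt_mult)

lemma sq_int_bounded_support:
  fixes u :: "'a::euclidean_space \<Rightarrow> complex"
  assumes [measurable]: "u \<in> borel_measurable borel" and "\<And>x. norm (u x) \<le> B" "\<And>x. norm x > r \<Longrightarrow> u x = 0"
  shows "sq_int u"
  unfolding sq_int_def
proof
  show "integrable lborel (\<lambda>x. (norm (u x))\<^sup>2)"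
  proof (rule Bochner_Integration.integrable_bound)
    show "integrable lborel (\<lambda>x::'a. B\<^sup>2 * indicat_real (cball 0 r) x)"
      by (intro integrable_mult_right)
        (simp add: integrable_indicator_iff emeasure_lborel_cball_finite[unfolded infinity_ennreal_def])
    show "AE x in lborel. norm ((norm (u x))\<^sup>2) \<le> norm (B\<^sup>2 * indicat_real (cball 0 r) x)"
      using assms(2,3) by (intro AE_I2) (auto simp: indicator_def power_mono)
  qed measurable
qed fact

lemma continuous_bounded_support:
  fixes u :: "'a::euclidean_space \<Rightarrow> complex"
  assumes "continuous_on UNIV u" "\<And>x. norm x > r \<Longrightarrow> u x = 0"
  obtains B where "B > 0" "\<And>x. norm (u x) \<le> B"
proof -
  have "bounded (u ` cball 0 r)"
    by (intro compact_imp_bounded compact_continuous_image continuous_on_subset[OF assms(1)]) auto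
  then obtain B where B: "B > 0" "\<And>x. norm x \<le> r \<Longrightarrow> norm (u x) \<le> B"
    unfolding bounded_pos by (auto simp: dist_norm)
  have "norm (u x) \<le> B" for x
    using B assms(2)[of x] by (cases "norm x \<le> r") auto
  with B(1) show ?thesis by (rule that)
qed

lemma sq_int_continuous_support:
  fixes u :: "'a::euclidean_space \<Rightarrow> complex"
  assumes "continuous_on UNIV u" "\<And>x. norm x > r \<Longrightarrow> u x = 0"
  shows "sq_int u"
  by (metis assms borel_measurable_continuous_onI continuous_bounded_support sq_int_bounded_support)

lemma l2_mono:
  assumes "sq_int u" "sq_int v" "\<And>x. norm (u x) \<le> norm (v x)"
  shows "l2 u \<le> l2 v"
  unfolding l2_def
proof (intro real_sqrt_le_mono integral_mono)
  fix x show "(norm (u x))\<^sup>2 \<le> (norm (v x))\<^sup>2" using assms(3) by (intro power_mono) auto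
qed (use assms(1,2) in \<open>auto simp: sq_int_def\<close>)

section \<open>Unitary dilations\<close>

lemma lborel_scale:
  assumes "c > 0"
  shows "lborel = density (distr lborel borel (\<lambda>x::'a::euclidean_space. c *\<^sub>R x)) (\<lambda>_. ennreal (c ^ DIM('a)))"
  using lborel_affine[of c 0] assms by (simp add: ennreal_power)

lemma nn_integral_scale:
  fixes f :: "'a::euclidean_space \<Rightarrow> ennreal"
  assumes "c > 0" and [measurable]: "f \<in> borel_measurable borel"
  shows "(\<integral>\<^sup>+x. f x \<partial>lborel) = ennreal (c ^ DIM('a)) * (\<integral>\<^sup>+x. f (c *\<^sub>R x) \<partial>lborel)"
  by (subst lborel_scale[OF assms(1)])
     (simp add: nn_integral_density nn_integral_distr nn_integral_cmult)

lemma integral_scale: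
  fixes f :: "'a::euclidean_space \<Rightarrow> 'b::{banach, second_countable_topology}"
  assumes "c > 0" and [measurable]: "f \<in> borel_measurable borel"
  shows "(\<integral>x. f x \<partial>lborel) = c ^ DIM('a) *\<^sub>R (\<integral>x. f (c *\<^sub>R x) \<partial>lborel)"
  using assms(1)
  by (subst lborel_scale[OF assms(1)]) (simp add: integral_density integral_distr)

lemma integrable_scale:
  fixes f :: "'a::euclidean_space \<Rightarrow> 'b::{banach, second_countable_topology}"
  assumes "c > 0" and [measurable]: "f \<in> borel_measurable borel" and "integrable lborel f"
  shows "integrable lborel (\<lambda>x. f (c *\<^sub>R x))"
proof -
  have "integrable lborel (\<lambda>x. c ^ DIM('a) *\<^sub>R f (c *\<^sub>R x))"
    using assms(3,1)
    by (subst (asm) lborel_scale[OF assms(1)]) (simp add: integrable_density integrable_distr_eq)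
  from integrable_scaleR_right[OF this, of "1 / c ^ DIM('a)"] assms(1) show ?thesis
    by simp
qed

text \<open>The factor makes the dilations unitary; in logarithmic radial coordinates they are the translations.\<close>

definition dil :: "real \<Rightarrow> ('a::euclidean_space \<Rightarrow> complex) \<Rightarrow> 'a \<Rightarrow> complex" where
  "dil s u x = exp (real DIM('a) * s / 2) *\<^sub>R u (exp s *\<^sub>R x)"

lemma dil_measurable [measurable]:
  assumes [measurable]: "u \<in> borel_measurable borel"
  shows "dil s u \<in> borel_measurable borel"
  unfolding dil_def[abs_def] by measurable

lemma dil_0 [simp]: "dil 0 u = u"
  by (simp add: dil_def fun_eq_iff)

lemma dil_dil: "dil s (dil t u) = dil (s + t) (u :: 'a::euclidean_space \<Rightarrow> complex)"
proof
  fix x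
  have "real DIM('a) * (s + t) / 2 = real DIM('a) * s / 2 + real DIM('a) * t / 2"
    by (simp add: algebra_simps add_divide_distrib)
  then show "dil s (dil t u) x = dil (s + t) u x"
    by (simp only: dil_def scaleR_scaleR exp_add mult.commute[of "exp t"])
qed

lemma sq_int_dil:
  assumes "sq_int u" shows "sq_int (dil s u)"
  unfolding sq_int_def
proof
  have [measurable]: "u \<in> borel_measurable borel" using assms by (auto simp: sq_int_def)
  show "dil s u \<in> borel_measurable borel" by measurable
  show "integrable lborel (\<lambda>x. (norm (dil s u x))\<^sup>2)"
    using assms integrable_scale[of "exp s" "\<lambda>x. (norm (u x))\<^sup>2"]
    by (auto simp: sq_int_def dil_def power_mult_distrib)
qed

lemma l2_dil:
  fixes u :: "'a::euclidean_space \<Rightarrow> complex"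
  assumes "sq_int u" shows "l2 (dil s u) = l2 u"
proof -
  have [measurable]: "u \<in> borel_measurable borel" using assms by (auto simp: sq_int_def)
  have "(exp (real DIM('a) * s / 2))\<^sup>2 = exp s ^ DIM('a)"
    by (simp add: exp_of_nat_mult[symmetric] exp_double[symmetric])
  then show ?thesis
    using integral_scale[of "exp s" "\<lambda>x. (norm (u x))\<^sup>2"]
    by (simp add: l2_def dil_def power_mult_distrib)
qed

lemma integral_dil_mult:
  fixes u v :: "'a::euclidean_space \<Rightarrow> complex"
  assumes [measurable]: "u \<in> borel_measurable borel" "v \<in> borel_measurable borel"
  shows "(\<integral>x. dil s u x * v x \<partial>lborel) = (\<integral>x. u x * dil (-s) v x \<partial>lborel)"
proof -
  have "(\<integral>x. u x * dil (-s) v x \<partial>lborel)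
     = exp s ^ DIM('a) *\<^sub>R (\<integral>x. u (exp s *\<^sub>R x) * dil (-s) v (exp s *\<^sub>R x) \<partial>lborel)"
    by (rule integral_scale) auto
  also have "\<dots> = (\<integral>x. exp s ^ DIM('a) *\<^sub>R (u (exp s *\<^sub>R x) * dil (-s) v (exp s *\<^sub>R x)) \<partial>lborel)"
    by simp
  also have "\<dots> = (\<integral>x. dil s u x * v x \<partial>lborel)"
    by (intro Bochner_Integration.integral_cong refl)
       (simp add: dil_def exp_of_nat_mult[symmetric] exp_add[symmetric] scaleR_scaleR[symmetric]
         del: scaleR_scaleR, simp add: exp_add[symmetric] exp_minus field_simps)
  finally show ?thesis ..
qed

section \<open>Test functions are dense\<close>

text \<open>The functions \<open>exp (- 1 / t) / t ^ m\<close>, cut off at \<open>0\<close>. Admitting all powers of \<open>t\<close> makes the span closed under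
  differentiation, so that smoothness needs no separate induction on the order of the derivative.\<close>

definition flat :: "nat \<Rightarrow> real \<Rightarrow> real" where
  "flat m t = (if t > 0 then exp (- (1 / t)) / t ^ m else 0)"

lemma flat_tendsto_0: "(flat m \<longlongrightarrow> 0) (at_right 0)"
proof -
  \<comment> \<open>In the variable \<open>1 / t\<close> this is the growth of the exponential against a power.\<close>
  have "((\<lambda>t::real. inverse t ^ m / exp (inverse t)) \<longlongrightarrow> 0) (at_right 0)"
    by (rule filterlim_compose[OF tendsto_power_div_exp_0 filterlim_inverse_at_top_right])
  moreover have "\<forall>\<^sub>F t in at_right 0. inverse t ^ m / exp (inverse t) = flat m t"
    unfolding eventually_at_filter
    by (rule always_eventually) (auto simp: flat_def exp_minus field_simps)
  ultimately show ?thesis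
    by (rule Lim_transform_eventually)
qed

lemma DERIV_flat: "(flat m has_real_derivative flat (m + 2) t - real m * flat (m + 1) t) (at t)"
proof (cases t "0::real" rule: linorder_cases)
  case less
  have "((\<lambda>_. 0) has_real_derivative 0) (at t)" by simp
  then have "(flat m has_real_derivative 0) (at t)"
    by (rule has_field_derivative_transform_within_open[where S="{..<0}"])
       (use less in \<open>auto simp: flat_def\<close>)
  then show ?thesis using less by (simp add: flat_def)
next
  case greater
  have "((\<lambda>t. exp (- (1 / t)) / t ^ m) has_real_derivative flat (m + 2) t - real m * flat (m + 1) t) (at t)"
  proof -
    have "((\<lambda>t. exp (- (1 / t)) / t ^ m) has_real_derivative
       (exp (- (1 / t)) * (1 / t\<^sup>2) * t ^ m - exp (- (1 / t)) * (real m * t ^ (m - 1))) / (t ^ m * t ^ m)) (at t)"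
      using greater by (auto intro!: derivative_eq_intros simp: power2_eq_square)
    also have "(exp (- (1 / t)) * (1 / t\<^sup>2) * t ^ m - exp (- (1 / t)) * (real m * t ^ (m - 1))) / (t ^ m * t ^ m)
      = flat (m + 2) t - real m * flat (m + 1) t"
      using greater by (cases m) (simp_all add: flat_def field_simps power2_eq_square)
    finally show ?thesis .
  qed
  then show ?thesis
    by (rule has_field_derivative_transform_within_open[where S="{0<..}"])
       (use greater in \<open>auto simp: flat_def\<close>)
next
  case equal
  \<comment> \<open>On the right the difference quotient of \<open>flat m\<close> at \<open>0\<close> is \<open>flat (Suc m)\<close>.\<close>
  have "((\<lambda>h. (flat m (0 + h) - flat m 0) / h) \<longlongrightarrow> 0) (at_right 0)"
    by (rule Lim_transform_eventually[OF flat_tendsto_0[of "Suc m"]], unfold eventually_at_filter,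
        rule always_eventually) (auto simp: flat_def)
  moreover have "((\<lambda>h. (flat m (0 + h) - flat m 0) / h) \<longlongrightarrow> 0) (at_left 0)"
    by (rule Lim_transform_eventually[OF tendsto_const], unfold eventually_at_filter,
        rule always_eventually) (auto simp: flat_def)
  ultimately have "((\<lambda>h. (flat m (0 + h) - flat m 0) / h) \<longlongrightarrow> 0) (at 0)"
    by (rule filterlim_split_at[rotated])
  then have "(flat m has_real_derivative 0) (at 0)"
    by (simp add: DERIV_def)
  then show ?thesis using equal by (simp add: flat_def)
qed

lemma flat_nonneg [simp]: "0 \<le> flat m t"
  by (simp add: flat_def)

lemma flat_0_le_1: "flat 0 t \<le> 1"
  by (simp add: flat_def)

lemma real_polynomial_function_derivative:
  fixes p :: "'a::real_inner \<Rightarrow> real"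
  assumes "real_polynomial_function p"
  shows "\<exists>D. (\<forall>x. (p has_derivative D x) (at x)) \<and> (\<forall>v. real_polynomial_function (\<lambda>x. D x v))"
  using assms
proof induction
  case (linear f)
  then show ?case
    by (intro exI[of _ "\<lambda>_. f"]) (auto intro: bounded_linear_imp_has_derivative)
next
  case (const c)
  then show ?case by (intro exI[of _ "\<lambda>_ _. 0"]) auto
next
  case (add f g)
  then obtain D E where "\<forall>x. (f has_derivative D x) (at x)" "\<forall>v. real_polynomial_function (\<lambda>x. D x v)"
    "\<forall>x. (g has_derivative E x) (at x)" "\<forall>v. real_polynomial_function (\<lambda>x. E x v)" by auto
  then show ?case
    by (intro exI[of _ "\<lambda>x v. D x v + E x v"]) (auto intro!: has_derivative_add)
next
  case (mult f g)
  then obtain D E where "\<forall>x. (f has_derivative D x) (at x)" "\<forall>v. real_polynomial_function (\<lambda>x. D x v)"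
    "\<forall>x. (g has_derivative E x) (at x)" "\<forall>v. real_polynomial_function (\<lambda>x. E x v)" by auto
  with mult.hyps show ?case
    by (intro exI[of _ "\<lambda>x v. f x * E x v + D x v * g x"])
      (auto intro!: has_derivative_mult real_polynomial_function.intros(3) real_polynomial_function.intros(4))
qed

text \<open>The span of the functions \<open>p(x) flat\<^sub>m (R\<^sup>2 - \<bar>x\<bar>\<^sup>2)\<close> with polynomials \<open>p\<close>. It is closed under partial
  derivatives (\<open>bump_derivative\<close>), hence consists of smooth functions, and by the factors \<open>p\<close> it is large enough
  for the theorem of Stone and Weierstrass.\<close>

inductive bump :: "real \<Rightarrow> ('a::real_inner \<Rightarrow> complex) \<Rightarrow> bool" for R where
  base: "real_polynomial_function p \<Longrightarrow> bump R (\<lambda>x. c * of_real (p x * flat m (R\<^sup>2 - (norm x)\<^sup>2)))"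
| add: "bump R \<phi> \<Longrightarrow> bump R \<psi> \<Longrightarrow> bump R (\<lambda>x. \<phi> x + \<psi> x)"

lemma bump_derivative:
  fixes \<phi> :: "'a::real_inner \<Rightarrow> complex"
  assumes "bump R \<phi>"
  shows "\<exists>D. (\<forall>x. (\<phi> has_derivative D x) (at x)) \<and> (\<forall>v. bump R (\<lambda>x. D x v))"
  using assms
proof induction
  case (base p c m)
  then obtain D where D: "\<And>x. (p has_derivative D x) (at x)" "\<And>v. real_polynomial_function (\<lambda>x. D x v)"
    using real_polynomial_function_derivative[of p] by auto
  let ?F = "\<lambda>m x::'a. flat m (R\<^sup>2 - (norm x)\<^sup>2)"
  let ?D = "\<lambda>x v. c * of_real (D x v * ?F m x)
     + (c * of_real ((-2 * p x * (x \<bullet> v)) * ?F (m + 2) x)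
     + c * of_real ((2 * real m * p x * (x \<bullet> v)) * ?F (m + 1) x))"
  have "((\<lambda>x. c * of_real (p x * ?F m x)) has_derivative ?D x) (at x)" for x
  proof -
    have n: "((\<lambda>x::'a. R\<^sup>2 - (norm x)\<^sup>2) has_derivative (\<lambda>v. - 2 * (x \<bullet> v))) (at x)"
      unfolding power2_norm_eq_inner
      by (auto intro!: derivative_eq_intros simp: inner_commute)
    have "(?F m has_derivative (\<lambda>v. - 2 * (x \<bullet> v) *
        (flat (m + 2) (R\<^sup>2 - (norm x)\<^sup>2) - real m * flat (m + 1) (R\<^sup>2 - (norm x)\<^sup>2)))) (at x)"
      using has_derivative_compose[OF n DERIV_flat[of m, unfolded has_field_derivative_def]]
      by (simp add: mult.commute)
    from has_derivative_mult[OF D(1)[of x] this]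
    have "((\<lambda>x. c * of_real (p x * ?F m x)) has_derivative
       (\<lambda>v. c * of_real (p x * (- 2 * (x \<bullet> v) *
        (flat (m + 2) (R\<^sup>2 - (norm x)\<^sup>2) - real m * flat (m + 1) (R\<^sup>2 - (norm x)\<^sup>2)))
        + D x v * ?F m x))) (at x)"
      by (intro has_derivative_mult_right bounded_linear.has_derivative[OF bounded_linear_of_real])
    then show ?thesis
      by (rule has_derivative_eq_rhs) (auto simp: algebra_simps)
  qed
  moreover have "bump R (\<lambda>x. ?D x v)" for v
    by (intro bump.intros D(2) real_polynomial_function.intros(4) real_polynomial_function.intros(2) base
        real_polynomial_function.intros(1)[OF bounded_linear_inner_left])
  ultimately show ?case by (intro exI[of _ ?D] conjI allI)
next
  case (add \<phi> \<psi>)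
  then obtain D E where "\<forall>x. (\<phi> has_derivative D x) (at x)" "\<forall>v. bump R (\<lambda>x. D x v)"
    "\<forall>x. (\<psi> has_derivative E x) (at x)" "\<forall>v. bump R (\<lambda>x. E x v)" by auto
  then show ?case
    by (intro exI[of _ "\<lambda>x v. D x v + E x v"]) (auto intro!: has_derivative_add bump.add)
qed

lemma bump_eq_0:
  assumes "bump R \<phi>" "norm x \<ge> R" "R > 0"
  shows "\<phi> x = 0"
  using assms(1)
proof induction
  case (base p c m)
  have "R\<^sup>2 \<le> (norm x)\<^sup>2" using assms by (intro power_mono) auto
  then show ?case by (simp add: flat_def)
qed simp

lemma bump_test_function:
  fixes \<phi> :: "real^'n \<Rightarrow> complex"
  assumes "bump R \<phi>" "R > 0"
  shows "test_function \<phi>"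
proof -
  have partial: "bump R (partial_deriv j \<psi>)" if bp: "bump R \<psi>" for j and \<psi> :: "real^'n \<Rightarrow> complex"
  proof -
    obtain D where D: "\<And>x. (\<psi> has_derivative D x) (at x)" "\<And>v. bump R (\<lambda>x. D x v)"
      using bump_derivative[OF bp] by auto
    have "partial_deriv j \<psi> = (\<lambda>x. D x (axis j 1))"
      using frechet_derivative_at[OF D(1)] by (simp add: partial_deriv_def fun_eq_iff)
    with D(2) show ?thesis by simp
  qed
  have "bump R (foldr partial_deriv js \<phi>)" for js
    using assms(1) by (induction js) (auto intro: partial)
  then have "foldr partial_deriv js \<phi> differentiable_on UNIV" for js
    using bump_derivative by (fastforce simp: differentiable_on_def differentiable_def)
  moreover have "{x. \<phi> x \<noteq> 0} \<subseteq> cball 0 R"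
    using bump_eq_0[OF assms(1) _ assms(2)] by force
  then have "compact (closure {x. \<phi> x \<noteq> 0})"
    using bounded_subset[OF bounded_cball] by (auto simp: compact_closure)
  ultimately show ?thesis by (simp add: test_function_def)
qed

lemma test_function_differentiable:
  "test_function \<phi> \<Longrightarrow> \<phi> differentiable (at x)"
  using spec[of "\<lambda>js. foldr partial_deriv js \<phi> differentiable_on UNIV" "[]"]
  by (auto simp: test_function_def differentiable_on_def)

lemma test_function_partial:
  assumes "test_function \<phi>"
  shows "test_function (partial_deriv j \<phi>)"
  unfolding test_function_def
proof (intro conjI allI)
  fix js
  show "foldr partial_deriv js (partial_deriv j \<phi>) differentiable_on UNIV"
    using assms spec[of "\<lambda>js. foldr partial_deriv js \<phi> differentiable_on UNIV" "js @ [j]"]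
    by (auto simp: test_function_def)
  have "partial_deriv j \<phi> x = 0" if "x \<notin> closure {x. \<phi> x \<noteq> 0}" for x
  proof -
    have "((\<lambda>_. 0) has_derivative (\<lambda>_. 0)) (at x)" by simp
    then have "(\<phi> has_derivative (\<lambda>_. 0)) (at x)"
      by (rule has_derivative_transform_within_open[where s="- closure {x. \<phi> x \<noteq> 0}"])
        (use that closure_subset[of "{x. \<phi> x \<noteq> 0}"] in auto)
    from frechet_derivative_at[OF this] have "frechet_derivative \<phi> (at x) (axis j 1) = 0"
      by (metis (no_types))
    then show ?thesis by (simp add: partial_deriv_def)
  qed
  then have "{x. partial_deriv j \<phi> x \<noteq> 0} \<subseteq> closure {x. \<phi> x \<noteq> 0}" by auto
  then have "closure {x. partial_deriv j \<phi> x \<noteq> 0} \<subseteq> closure {x. \<phi> x \<noteq> 0}"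
    by (rule closure_minimal) simp
  with assms show "compact (closure {x. partial_deriv j \<phi> x \<noteq> 0})"
    unfolding test_function_def by (metis closed_closure closed_Int_compact inf.absorb1)
qed

lemma test_function_continuous: "test_function \<phi> \<Longrightarrow> continuous_on UNIV \<phi>"
  by (simp add: test_function_differentiable continuous_at_imp_continuous_on differentiable_imp_continuous_within)

lemma test_function_support:
  assumes "test_function \<phi>"
  obtains r where "r > 0" "\<And>x. norm x > r \<Longrightarrow> \<phi> x = 0"
proof -
  have "bounded (closure {x. \<phi> x \<noteq> 0})"
    using assms by (auto simp: test_function_def intro: compact_imp_bounded)
  then obtain r where "r > 0" "\<And>x. x \<in> closure {x. \<phi> x \<noteq> 0} \<Longrightarrow> norm x \<le> r"
    unfolding bounded_pos by auto
  with closure_subset[of "{x. \<phi> x \<noteq> 0}"] show ?thesis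
    by (intro that[of r]) (auto simp: subset_eq not_less[symmetric])
qed

lemma sq_int_test_function:
  assumes "test_function \<phi>" shows "sq_int \<phi>"
  by (metis assms sq_int_continuous_support test_function_continuous test_function_support)

text \<open>The elements of the span that are used for approximation: a fixed cutoff times an arbitrary polynomial.\<close>

lemma bump_complex_polynomial:
  fixes q :: "'a::real_inner \<Rightarrow> complex"
  assumes "polynomial_function q"
  shows "bump R (\<lambda>x. q x * of_real (flat 0 (R\<^sup>2 - (norm x)\<^sup>2)))"
proof -
  have "real_polynomial_function (Re \<circ> q)" "real_polynomial_function (Im \<circ> q)"
    using assms bounded_linear_Re bounded_linear_Im by (auto simp: polynomial_function_def)
  then have "bump R (\<lambda>x. 1 * of_real ((Re \<circ> q) x * flat 0 (R\<^sup>2 - (norm x)\<^sup>2))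
     + \<i> * of_real ((Im \<circ> q) x * flat 0 (R\<^sup>2 - (norm x)\<^sup>2)))"
    by (intro bump.intros)
  moreover have "1 * of_real ((Re \<circ> q) x * flat 0 (R\<^sup>2 - (norm x)\<^sup>2))
     + \<i> * of_real ((Im \<circ> q) x * flat 0 (R\<^sup>2 - (norm x)\<^sup>2))
     = q x * of_real (flat 0 (R\<^sup>2 - (norm x)\<^sup>2))" for x
    by (simp add: complex_eq_iff)
  ultimately show ?thesis by (simp only:)
qed

text \<open>A Lebesgue measurable function is almost everywhere a limit of continuous functions, and these are
  approximated on a ball by polynomials, uniformly. Multiplication by a smooth cutoff turns the polynomials into test
  functions.\<close>

lemma test_functions_dense_bounded:
  fixes v :: "real^'n \<Rightarrow> complex"
  assumes [measurable]: "v \<in> borel_measurable borel" and bound: "\<And>x. norm (v x) \<le> M"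
    and supp: "\<And>x. norm x > r \<Longrightarrow> v x = 0" and "e > 0"
  shows "\<exists>\<phi>. test_function \<phi> \<and> l2 (\<lambda>x. v x - \<phi> x) < e"
proof -
  \<comment> \<open>The cutoff \<open>\<rho>\<close> is supported in a larger ball, hence bounded below on the support of \<open>v\<close>. It need not
    equal \<open>1\<close> there: the quotient \<open>v / \<rho>\<close> is approximated instead of \<open>v\<close>.\<close>
  define R where "R = \<bar>r\<bar> + 1"
  have R: "R > 0" "r < R" "\<bar>r\<bar> < R" by (auto simp: R_def)
  define \<rho> where "\<rho> x = flat 0 (R\<^sup>2 - (norm x)\<^sup>2)" for x :: "real^'n"
  define c where "c = flat 0 (R\<^sup>2 - r\<^sup>2)"
  have "r\<^sup>2 < R\<^sup>2" using R by (metis abs_le_square_iff abs_of_pos linorder_not_le)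
  then have c: "c > 0" by (simp add: c_def flat_def)
  have \<rho>c: "\<rho> x \<ge> c" if "norm x \<le> r" for x
  proof -
    have 1: "(norm x)\<^sup>2 \<le> r\<^sup>2" using that by (intro power_mono) auto
    then have "1 / (R\<^sup>2 - (norm x)\<^sup>2) \<le> 1 / (R\<^sup>2 - r\<^sup>2)"
      using \<open>r\<^sup>2 < R\<^sup>2\<close> by (intro divide_left_mono) auto
    then show ?thesis using \<open>r\<^sup>2 < R\<^sup>2\<close> 1 by (simp add: \<rho>_def c_def flat_def)
  qed
  have [measurable]: "\<rho> \<in> borel_measurable borel"
  proof -
    have "flat 0 \<in> borel_measurable borel" unfolding flat_def[abs_def] by measurable
    then show ?thesis unfolding \<rho>_def[abs_def] by measurable
  qed
  have M: "M \<ge> 0" using bound norm_ge_zero order_trans by blast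
  define v' where "v' x = v x / of_real (\<rho> x)" for x
  have v'[measurable]: "v' \<in> borel_measurable borel"
    unfolding v'_def[abs_def] by measurable
  have \<rho>v': "of_real (\<rho> x) * v' x = v x" for x
    using \<rho>c[of x] supp[of x] c by (cases "norm x \<le> r") (auto simp: v'_def)
  have v'_bound: "norm (v' x) \<le> M / c" for x
  proof (cases "norm x \<le> r")
    case True
    then show ?thesis
      using \<rho>c[of x] bound[of x] c M by (auto simp: v'_def norm_divide intro!: frac_le)
  qed (use supp[of x] c M in \<open>auto simp: v'_def\<close>)
  have "v' measurable_on UNIV"
    by (intro lebesgue_measurable_imp_measurable_on measurable_completion) auto
  then obtain N g where N: "negligible N" and g: "\<And>k. continuous_on UNIV (g k)"
    "\<And>x. x \<notin> N \<Longrightarrow> (\<lambda>k. g k x) \<longlonglongrightarrow> v' x"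
    unfolding measurable_on_def by auto
  define B where "B = M / c"
  have B: "0 \<le> B" using M c by (simp add: B_def)
  \<comment> \<open>Projecting the values to a ball keeps the approximants continuous and makes them uniformly bounded, as
    dominated convergence requires.\<close>
  define h where "h k x = closest_point (cball 0 B) (g k x)" for k x
  have ne: "convex (cball (0::complex) B)" "closed (cball (0::complex) B)" "cball (0::complex) B \<noteq> {}"
    using B by auto
  have h_cont: "continuous_on UNIV (h k)" for k
    unfolding h_def by (rule continuous_on_compose2[OF continuous_on_closest_point[OF ne] g(1)]) auto
  have h_bound: "norm (h k x) \<le> B" for k x
    using closest_point_in_set[OF ne(2,3), of "g k x"] by (simp add: h_def)
  have h_lim: "(\<lambda>k. h k x) \<longlonglongrightarrow> v' x" if "x \<notin> N" for x
  proof -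
    have "(\<lambda>k. h k x) \<longlonglongrightarrow> closest_point (cball 0 B) (v' x)"
      unfolding h_def
      by (rule isCont_tendsto_compose[OF continuous_at_closest_point[OF ne] g(2)[OF that]])
    also have "closest_point (cball 0 B) (v' x) = v' x"
      using v'_bound[of x] by (intro closest_point_self) (simp add: B_def)
    finally show ?thesis .
  qed
  have "\<exists>q. polynomial_function q \<and> (\<forall>x\<in>cball 0 R. norm (h k x - q x) < 1 / real (Suc k))" for k
    by (rule Stone_Weierstrass_polynomial_function) (auto intro: continuous_on_subset[OF h_cont])
  then obtain q where q: "\<And>k. polynomial_function (q k)"
    "\<And>k x. norm x \<le> R \<Longrightarrow> norm (h k x - q k x) < 1 / real (Suc k)"
    by (metis mem_cball_0)
  define \<phi> where "\<phi> k x = q k x * of_real (\<rho> x)" for k x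
  have bp: "bump R (\<phi> k)" for k
    using bump_complex_polynomial[OF q(1)[of k], of R] by (simp add: \<phi>_def[abs_def] \<rho>_def)
  have test: "test_function (\<phi> k)" for k
    by (rule bump_test_function[OF bp R(1)])
  have [measurable]: "\<phi> k \<in> borel_measurable borel" for k
    by (intro borel_measurable_continuous_onI test_function_continuous test)
  have \<rho>1: "\<bar>\<rho> x\<bar> \<le> 1" for x by (simp add: \<rho>_def flat_0_le_1)
  \<comment> \<open>The polynomials are close to \<open>v / \<rho>\<close> only on the ball of radius \<open>R\<close>; outside it both \<open>\<rho>\<close> and \<open>v\<close>
    vanish.\<close>
  have lim: "(\<lambda>k. \<phi> k x) \<longlonglongrightarrow> v x" if x: "x \<notin> N" for x
  proof (cases "norm x \<le> R")
    case True
    have "(\<lambda>k. h k x - q k x) \<longlonglongrightarrow> 0"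
      by (rule Lim_null_comparison[OF _ LIMSEQ_Suc[OF lim_1_over_n]])
        (use q(2)[OF True] in \<open>auto intro!: always_eventually less_imp_le\<close>)
    from tendsto_diff[OF h_lim[OF x] this] have "(\<lambda>k. q k x) \<longlonglongrightarrow> v' x" by simp
    from tendsto_mult_right[OF this, of "of_real (\<rho> x)"] show ?thesis
      using \<rho>v'[of x] by (simp add: \<phi>_def mult.commute)
  next
    case False
    then have "\<phi> k x = 0" for k using bump_eq_0[OF bp, of x] R by simp
    then show ?thesis using False supp[of x] R by simp
  qed
  have \<phi>_bound: "norm (v x - \<phi> k x) \<le> (M + B + 1) * indicator (cball 0 R) x" for k x
  proof (cases "norm x \<le> R")
    case True
    have "norm (q k x) \<le> norm (h k x) + norm (h k x - q k x)"
      by (metis norm_minus_commute norm_triangle_sub)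
    also have "\<dots> \<le> B + 1"
    proof (intro add_mono h_bound)
      have "1 / real (Suc k) \<le> 1" by simp
      with q(2)[OF True, of k] show "norm (h k x - q k x) \<le> 1" by linarith
    qed
    finally have "norm (\<phi> k x) \<le> (B + 1) * 1"
      unfolding \<phi>_def norm_mult using \<rho>1[of x] B by (intro mult_mono) auto
    with bound[of x] norm_triangle_ineq4[of "v x" "\<phi> k x"] True show ?thesis by simp
  next
    case False
    then show ?thesis
      using bump_eq_0[OF bp, of x] supp[of x] R by (simp add: indicator_def)
  qed
  have "(\<lambda>k. \<integral>x. (norm (v x - \<phi> k x))\<^sup>2 \<partial>lborel) \<longlonglongrightarrow> (\<integral>x. 0 \<partial>(lborel :: (real^'n) measure))"
  proof (rule integral_dominated_convergence)
    show "integrable lborel (\<lambda>x::real^'n. (M + B + 1)\<^sup>2 * indicat_real (cball 0 R) x)"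
      by (intro integrable_mult_right)
        (simp add: integrable_indicator_iff emeasure_lborel_cball_finite[unfolded infinity_ennreal_def])
    have "AE x in lebesgue. x \<notin> N"
      using N by (simp add: AE_not_in negligible_iff_null_sets)
    then have "AE x in lborel. x \<notin> N" by (simp add: AE_completion_iff)
    then show "AE x in lborel. (\<lambda>k. (norm (v x - \<phi> k x))\<^sup>2) \<longlonglongrightarrow> 0"
    proof eventually_elim
      case (elim x)
      from tendsto_diff[OF tendsto_const lim[OF elim], of "v x"]
      have "(\<lambda>k. v x - \<phi> k x) \<longlonglongrightarrow> 0" by simp
      from tendsto_power[OF tendsto_norm[OF this], of 2] show ?case by simp
    qed
    show "AE x in lborel. norm ((norm (v x - \<phi> k x))\<^sup>2) \<le> (M + B + 1)\<^sup>2 * indicat_real (cball 0 R) x" for k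
    proof (intro AE_I2)
      fix x :: "real^'n"
      have "(norm (v x - \<phi> k x))\<^sup>2 \<le> ((M + B + 1) * indicator (cball 0 R) x)\<^sup>2"
        by (intro power_mono \<phi>_bound) auto
      then show "norm ((norm (v x - \<phi> k x))\<^sup>2) \<le> (M + B + 1)\<^sup>2 * indicat_real (cball 0 R) x"
        by (auto simp: indicator_def split: if_splits)
    qed
  qed measurable
  from tendsto_real_sqrt[OF this] have "(\<lambda>k. l2 (\<lambda>x. v x - \<phi> k x)) \<longlonglongrightarrow> 0"
    by (simp add: l2_def)
  from order_tendstoD(2)[OF this \<open>e > 0\<close>] obtain k where "l2 (\<lambda>x. v x - \<phi> k x) < e"
    by (auto simp: eventually_sequentially)
  with test show ?thesis by blast
qed

lemma l2_truncate_tendsto: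
  fixes v :: "'a::euclidean_space \<Rightarrow> complex"
  assumes "sq_int v"
  shows "(\<lambda>k. l2 (\<lambda>x. v x - (if norm (v x) \<le> real k then v x else 0))) \<longlonglongrightarrow> 0"
proof -
  have [measurable]: "v \<in> borel_measurable borel" using assms by (simp add: sq_int_def)
  have "(\<lambda>k. \<integral>x. (norm (v x - (if norm (v x) \<le> real k then v x else 0)))\<^sup>2 \<partial>lborel) \<longlonglongrightarrow> (\<integral>x. 0 \<partial>(lborel :: 'a measure))"
  proof (rule integral_dominated_convergence)
    show "integrable lborel (\<lambda>x. (norm (v x))\<^sup>2)" using assms by (simp add: sq_int_def)
    have "(\<lambda>k. (norm (v x - (if norm (v x) \<le> real k then v x else 0)))\<^sup>2) \<longlonglongrightarrow> 0" for x
    proof (rule tendsto_eventually)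
      have "\<forall>\<^sub>F k in sequentially. norm (v x) \<le> real k"
        using filterlim_real_sequentially by (auto simp: filterlim_at_top)
      then show "\<forall>\<^sub>F k in sequentially. (norm (v x - (if norm (v x) \<le> real k then v x else 0)))\<^sup>2 = 0"
        by eventually_elim simp
    qed
    then show "AE x in lborel. (\<lambda>k. (norm (v x - (if norm (v x) \<le> real k then v x else 0)))\<^sup>2) \<longlonglongrightarrow> 0"
      by simp
  qed auto
  from tendsto_real_sqrt[OF this] show ?thesis by (simp add: l2_def)
qed

text \<open>Square integrable functions with bounded support are approximated by their truncations, to which the
  previous approximation applies.\<close>

theorem test_functions_dense:
  fixes v :: "real^'n \<Rightarrow> complex"
  assumes v: "sq_int v" and supp: "\<And>x. norm x > r \<Longrightarrow> v x = 0" and "e > 0"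
  obtains \<phi> where "test_function \<phi>" "l2 (\<lambda>x. v x - \<phi> x) < e"
proof -
  have [measurable]: "v \<in> borel_measurable borel" using v by (simp add: sq_int_def)
  define t where "t k x = (if norm (v x) \<le> real k then v x else 0)" for k x
  have t[measurable]: "t k \<in> borel_measurable borel" for k unfolding t_def[abs_def] by measurable
  have st: "sq_int (t k)" for k
    by (rule sq_int_bound[OF v]) (auto simp: t_def)
  have "e / 2 > 0" using \<open>e > 0\<close> by simp
  from order_tendstoD(2)[OF l2_truncate_tendsto[OF v] this]
  obtain k where k: "l2 (\<lambda>x. v x - t k x) < e / 2"
    by (auto simp: eventually_sequentially t_def)
  obtain \<phi> where \<phi>: "test_function \<phi>" "l2 (\<lambda>x. t k x - \<phi> x) < e / 2"
  proof -
    have "norm (t k x) \<le> real k" "norm x > r \<Longrightarrow> t k x = 0" for x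
      using supp by (auto simp: t_def)
    from test_functions_dense_bounded[OF t this \<open>e / 2 > 0\<close>] show ?thesis
      using that by blast
  qed
  have "l2 (\<lambda>x. (v x - t k x) + (t k x - \<phi> x)) \<le> l2 (\<lambda>x. v x - t k x) + l2 (\<lambda>x. t k x - \<phi> x)"
    by (intro l2_triangle sq_int_diff v st sq_int_test_function \<phi>)
  with k \<phi> show ?thesis by (intro that[of \<phi>]) auto
qed

section \<open>Polar coordinates\<close>

text \<open>The surface measure on the Borel sets; \<^const>\<open>sphere_measure\<close> is its completion. Product measures are
  formed with this one.\<close>

definition surface :: "(real^'n::finite) measure" where
  "surface = scale_measure (of_nat CARD('n))
     (distr (restrict_space lborel (ball 0 1 - {0})) (restrict_space borel (sphere 0 1))
        (\<lambda>x. x /\<^sub>R norm x))"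

lemma sphere_measure_eq: "sphere_measure = completion surface"
  by (simp add: sphere_measure_def surface_def)

lemma sets_surface [measurable_cong]: "sets (surface :: (real^'n::finite) measure) = sets (restrict_space borel (sphere 0 1))"
  by (simp add: surface_def)

lemma space_surface: "space (surface :: (real^'n::finite) measure) = sphere 0 1"
  by (simp add: surface_def space_restrict_space space_scale_measure)

lemma sphere_in_surface [measurable]: "sphere 0 1 \<in> sets (surface :: (real^'n::finite) measure)"
  using sets.top[of surface] by (simp add: space_surface)

lemma emeasure_surface:
  assumes "A \<in> sets (surface :: (real^'n::finite) measure)"
  shows "emeasure surface A =
    of_nat CARD('n) * emeasure lborel {x. x \<noteq> 0 \<and> norm x < 1 \<and> x /\<^sub>R norm x \<in> A}"
proof -
  have "A \<in> sets borel" "A \<subseteq> sphere 0 1"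
    using assms by (auto simp: sets_surface sets_restrict_space)
  with emeasure_sphere_measure[OF this] assms show ?thesis
    by (simp add: sphere_measure_eq)
qed

lemma emeasure_surface_sphere:
  "emeasure (surface :: (real^'n::finite) measure) (sphere 0 1) = of_nat CARD('n) * emeasure lborel (ball 0 1 :: (real^'n) set)"
proof -
  have "emeasure lborel {x::real^'n. x \<noteq> 0 \<and> norm x < 1 \<and> x /\<^sub>R norm x \<in> sphere 0 1}
     = emeasure lborel (ball 0 1 - {0} :: (real^'n) set)"
    by (intro arg_cong[where f="emeasure lborel"]) auto
  also have "\<dots> = emeasure lborel (ball 0 1 :: (real^'n) set)"
    by (intro emeasure_Diff_null_set) auto
  finally show ?thesis by (simp add: emeasure_surface)
qed

lemma finite_measure_surface: "finite_measure (surface :: (real^'n::finite) measure)"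
proof
  show "emeasure (surface :: (real^'n::finite) measure) (space surface) \<noteq> \<infinity>"
    using emeasure_lborel_ball_finite[of "0::real^'n" 1]
    by (simp add: space_surface emeasure_surface_sphere ennreal_mult_eq_top_iff)
qed

lemma measure_surface_pos: "measure (surface :: (real^'n::finite) measure) (sphere 0 1) > 0"
proof -
  interpret finite_measure "surface :: (real^'n::finite) measure" by (rule finite_measure_surface)
  have "emeasure lborel (ball 0 1 :: (real^'n) set) \<noteq> 0"
    using content_ball_pos[of 1 "0::real^'n"] by (auto simp: measure_def)
  then have "emeasure (surface :: (real^'n::finite) measure) (sphere 0 1) \<noteq> 0"
    by (simp add: emeasure_surface_sphere)
  then show ?thesis
    using emeasure_eq_measure zero_less_measure_iff by (metis ennreal_0 less_le measure_nonneg)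
qed

text \<open>The measure \<open>r\<^sup>n\<^sup>-\<^sup>1 dr\<close> on the half-line, as a Borel measure on the whole line.\<close>

definition radial :: "nat \<Rightarrow> real measure" where
  "radial n = density lborel (\<lambda>r. ennreal (r ^ (n - 1)) * indicator {0<..} r)"

lemma sets_radial [measurable_cong, simp]: "sets (radial n) = sets borel"
  by (simp add: radial_def)

lemma space_radial [simp]: "space (radial n) = UNIV"
  by (simp add: radial_def)

lemma emeasure_radial_lessThan:
  assumes "n > 0"
  shows "emeasure (radial n) {..<b} = (if b > 0 then ennreal (b ^ n / real n) else 0)"
proof (cases "b > 0")
  case True
  have "emeasure (radial n) {..<b} = (\<integral>\<^sup>+r. ennreal (r ^ (n - 1)) * indicator {0<..} r * indicator {..<b} r \<partial>lborel)"
    by (simp add: radial_def emeasure_density)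
  also have "\<dots> = (\<integral>\<^sup>+r. ennreal (r ^ (n - 1)) * indicator {0..b} r \<partial>lborel)"
    using AE_lborel_singleton[of 0] AE_lborel_singleton[of b]
    by (intro nn_integral_cong_AE, eventually_elim) (auto simp: indicator_def)
  also have "\<dots> = ennreal (b ^ n / real n - 0 ^ n / real n)"
  proof (rule nn_integral_FTC_Icc)
    fix x
    show "((\<lambda>r. r ^ n / real n) has_real_derivative x ^ (n - 1)) (at x)"
      using assms by (auto intro!: derivative_eq_intros)
  qed (use True in auto)
  finally show ?thesis using True assms by (simp add: power_0_left)
next
  case False
  have "emeasure (radial n) {..<b} = (\<integral>\<^sup>+r. ennreal (r ^ (n - 1)) * indicator {0<..} r * indicator {..<b} r \<partial>lborel)"
    by (simp add: radial_def emeasure_density)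
  also have "\<dots> = (\<integral>\<^sup>+r. 0 \<partial>(lborel :: real measure))"
    using False by (intro nn_integral_cong) (auto simp: indicator_def)
  finally show ?thesis using False by simp
qed

lemma sigma_finite_radial:
  assumes "n > 0" shows "sigma_finite_measure (radial n)"
proof
  show "\<exists>A. countable A \<and> A \<subseteq> sets (radial n) \<and> \<Union> A = space (radial n) \<and> (\<forall>a\<in>A. emeasure (radial n) a \<noteq> \<infinity>)"
    by (rule exI[of _ "range (\<lambda>k::nat. {..<real k})"])
       (use assms reals_Archimedean2 in \<open>auto simp: emeasure_radial_lessThan\<close>)
qed

text \<open>Truncated cones scale like \<open>b\<^sup>n\<close>. This homogeneity is all that polar coordinates need.\<close>

lemma emeasure_cone:
  fixes B :: "(real^'n::finite) set"
  assumes "B \<in> sets borel" "b > 0"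
  shows "emeasure lborel {x. x \<noteq> 0 \<and> norm x < b \<and> x /\<^sub>R norm x \<in> B}
    = ennreal (b ^ CARD('n)) * emeasure lborel {x. x \<noteq> 0 \<and> norm x < 1 \<and> x /\<^sub>R norm x \<in> B}"
proof -
  have [measurable]: "B \<in> sets borel" by fact
  let ?S = "\<lambda>b. {x::real^'n. x \<noteq> 0 \<and> norm x < b \<and> x /\<^sub>R norm x \<in> B}"
  have [measurable]: "?S b \<in> sets borel" for b by measurable
  have "emeasure lborel (?S b) = (\<integral>\<^sup>+x. indicator (?S b) x \<partial>lborel)" by simp
  also have "\<dots> = ennreal (b ^ CARD('n)) * (\<integral>\<^sup>+x. indicator (?S b) (b *\<^sub>R x) \<partial>lborel)"
    using nn_integral_scale[OF assms(2), of "indicator (?S b)"] by simp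
  also have "(\<integral>\<^sup>+x. indicator (?S b) (b *\<^sub>R x) \<partial>lborel) = (\<integral>\<^sup>+x. indicator (?S 1) x \<partial>lborel)"
    using assms(2) by (intro nn_integral_cong) (auto simp: indicator_def field_simps)
  finally show ?thesis by simp
qed

lemma polar_measurable:
  "(\<lambda>x::real^'n::finite. (norm x, x /\<^sub>R norm x)) \<in>
     restrict_space lborel (-{0}) \<rightarrow>\<^sub>M borel \<Otimes>\<^sub>M restrict_space borel (sphere 0 1)"
proof (rule measurable_Pair)
  show "norm \<in> borel_measurable (restrict_space lborel (-{0::real^'n}))"
    by (intro measurable_restrict_space1) simp
  show "(\<lambda>x::real^'n. x /\<^sub>R norm x) \<in> restrict_space lborel (-{0}) \<rightarrow>\<^sub>M restrict_space borel (sphere 0 1)"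
  proof (rule measurable_restrict_space2)
    show "(\<lambda>x::real^'n. x /\<^sub>R norm x) \<in> borel_measurable (restrict_space lborel (-{0}))"
      by (intro measurable_restrict_space1) simp
  qed (auto simp: space_restrict_space)
qed

lemma emeasure_polar_rectangle:
  fixes B :: "(real^'n::finite) set"
  assumes [measurable]: "B \<in> sets borel" and B: "B \<subseteq> sphere 0 1" and A: "A \<in> sets borel"
  shows "emeasure (radial CARD('n)) A * emeasure surface B
    = emeasure lborel {x. x \<noteq> 0 \<and> norm x \<in> A \<and> x /\<^sub>R norm x \<in> B}"
proof -
  let ?n = "CARD('n)"
  let ?K = "{x::real^'n. x \<noteq> 0 \<and> x /\<^sub>R norm x \<in> B}"
  have [measurable]: "?K \<in> sets borel" by measurable
  have Bs: "B \<in> sets surface" using assms by (auto simp: sets_surface sets_restrict_space)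
  \<comment> \<open>For fixed \<open>B\<close> both sides are measures in \<open>A\<close>. It suffices to compare them on the half-lines
    \<open>{..<b}\<close>, where homogeneity of the cone gives the value.\<close>
  define M1 where "M1 = scale_measure (emeasure surface B) (radial ?n)"
  define M2 where "M2 = distr (restrict_space lborel ?K) borel norm"
  have nm: "norm \<in> restrict_space lborel ?K \<rightarrow>\<^sub>M borel"
    by (intro measurable_restrict_space1) simp
  have M2: "emeasure M2 X = emeasure lborel {x. x \<noteq> 0 \<and> norm x \<in> X \<and> x /\<^sub>R norm x \<in> B}"
    if "X \<in> sets borel" for X
  proof -
    have "emeasure M2 X = emeasure (restrict_space lborel ?K) (norm -` X \<inter> ?K)"
      unfolding M2_def using that by (subst emeasure_distr[OF nm]) (auto simp: space_restrict_space)
    also have "\<dots> = emeasure lborel (norm -` X \<inter> ?K)"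
      by (intro emeasure_restrict_space) auto
    also have "norm -` X \<inter> ?K = {x. x \<noteq> 0 \<and> norm x \<in> X \<and> x /\<^sub>R norm x \<in> B}" by auto
    finally show ?thesis .
  qed
  have eq: "emeasure M1 {..<b} = emeasure M2 {..<b}" for b
  proof (cases "b > 0")
    case True
    have "emeasure M2 {..<b} = ennreal (b ^ ?n) * emeasure lborel {x. x \<noteq> 0 \<and> norm x < 1 \<and> x /\<^sub>R norm x \<in> B}"
      using emeasure_cone[OF assms(1) True] by (simp add: M2)
    also have "ennreal (b ^ ?n) = ennreal (b ^ ?n / real ?n) * of_nat ?n"
      using True by (simp add: ennreal_of_nat_eq_real_of_nat ennreal_mult[symmetric])
    finally show ?thesis
      using True by (simp add: M1_def emeasure_radial_lessThan emeasure_surface[OF Bs] ac_simps)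
  next
    case False
    have "\<not> norm x < b" for x :: "real^'n"
      using False norm_ge_zero[of x] by linarith
    then show ?thesis using False by (simp add: M1_def M2 emeasure_radial_lessThan)
  qed
  have "emeasure surface B \<noteq> \<infinity>"
    using finite_measure.emeasure_finite[OF finite_measure_surface] by simp
  have "M1 = M2"
  proof (rule measure_eqI_generator_eq)
    let ?E = "range (\<lambda>b::real. {..<b})"
    have "{..<a} \<inter> {..<b} = {..<min a b}" for a b :: real by auto
    then show "Int_stable ?E" by (auto simp: Int_stable_def)
    show "?E \<subseteq> Pow UNIV" by simp
    show "sets M1 = sigma_sets UNIV ?E"
      by (simp add: M1_def borel_Iio)
    show "sets M2 = sigma_sets UNIV ?E"
      by (simp add: M2_def borel_Iio)
    show "range (\<lambda>k::nat. {..<real k}) \<subseteq> ?E" by auto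
    show "(\<Union>k::nat. {..<real k}) = UNIV" using reals_Archimedean2 by auto
    show "emeasure M1 {..<real k} \<noteq> \<infinity>" for k
      using \<open>emeasure surface B \<noteq> \<infinity>\<close>
      by (simp add: M1_def emeasure_radial_lessThan ennreal_mult_eq_top_iff)
    show "\<And>X. X \<in> ?E \<Longrightarrow> emeasure M1 X = emeasure M2 X" using eq by auto
  qed
  moreover have "emeasure M1 A = emeasure (radial ?n) A * emeasure surface B"
    by (simp add: M1_def mult.commute)
  ultimately show ?thesis using M2[OF A] by simp
qed

text \<open>Lebesgue measure is the product of \<open>r\<^sup>n\<^sup>-\<^sup>1 dr\<close> and surface measure. Two measures on a product agree if they
  agree on rectangles, which is \<open>emeasure_polar_rectangle\<close>. The origin, a null set, has no polar coordinates.\<close>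

theorem polar_coordinates:
  "radial CARD('n) \<Otimes>\<^sub>M (surface :: (real^'n::finite) measure)
    = distr (restrict_space lborel (-{0})) (borel \<Otimes>\<^sub>M restrict_space borel (sphere 0 1))
        (\<lambda>x. (norm x, x /\<^sub>R norm x))" (is "_ = ?D")
proof (rule pair_measure_eqI)
  show "sigma_finite_measure (radial CARD('n))" by (rule sigma_finite_radial) simp
  show "sigma_finite_measure (surface :: (real^'n) measure)"
    by (intro finite_measure.axioms(1) finite_measure_surface)
  show "sets (radial CARD('n) \<Otimes>\<^sub>M (surface :: (real^'n) measure)) = sets ?D"
    by (simp cong: sets_pair_measure_cong add: sets_surface)
  fix A :: "real set" and B :: "(real^'n) set"
  assume A: "A \<in> sets (radial CARD('n))" and B: "B \<in> sets surface"
  then have B': "B \<in> sets (restrict_space borel (sphere 0 1))" "B \<in> sets borel" "B \<subseteq> sphere 0 1" and A': "A \<in> sets borel"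
    by (auto simp: sets_surface sets_restrict_space)
  have [measurable]: "A \<in> sets borel" "B \<in> sets borel" using A' B' by auto
  have "emeasure ?D (A \<times> B) = emeasure (restrict_space lborel (-{0}))
      {x::real^'n. x \<noteq> 0 \<and> norm x \<in> A \<and> x /\<^sub>R norm x \<in> B}"
    using A' B'(1) by (subst emeasure_distr[OF polar_measurable])
      (auto simp: space_restrict_space intro!: arg_cong[where f="emeasure (restrict_space lborel (- {0}))"])
  also have "\<dots> = emeasure lborel {x::real^'n. x \<noteq> 0 \<and> norm x \<in> A \<and> x /\<^sub>R norm x \<in> B}"
    by (intro emeasure_restrict_space) auto
  finally show "emeasure (radial CARD('n)) A * emeasure surface B = emeasure ?D (A \<times> B)"
    using emeasure_polar_rectangle[OF B'(2,3) A'] by simp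
qed

lemma measurable_scaleR_polar [measurable]:
  fixes F :: "real^'n::finite \<Rightarrow> 'b::topological_space"
  assumes [measurable]: "F \<in> borel_measurable borel"
  shows "(\<lambda>(r, \<omega>). F (r *\<^sub>R \<omega>)) \<in> borel_measurable (borel \<Otimes>\<^sub>M restrict_space borel (sphere 0 1))"
proof -
  have [measurable]: "(\<lambda>\<omega>. \<omega>) \<in> restrict_space borel (sphere 0 1) \<rightarrow>\<^sub>M (borel :: (real^'n) measure)"
    by (rule measurable_restrict_space1) simp
  show ?thesis by measurable
qed

lemma borel_measurable_on_ray:
  fixes F :: "real^'n::finite \<Rightarrow> 'b::topological_space"
  assumes "F \<in> borel_measurable borel"
  shows "(\<lambda>\<omega>. F (r *\<^sub>R \<omega>)) \<in> borel_measurable surface"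
  using measurable_compose[OF measurable_Pair1' measurable_scaleR_polar[OF assms], of r]
  by (simp add: measurable_cong_sets[OF sets_surface refl])

lemma nn_integral_polar:
  fixes F :: "real^'n::finite \<Rightarrow> ennreal"
  assumes [measurable]: "F \<in> borel_measurable borel"
  shows "(\<integral>\<^sup>+x. F x \<partial>lborel) = (\<integral>\<^sup>+r. (\<integral>\<^sup>+\<omega>. F (r *\<^sub>R \<omega>) \<partial>surface) \<partial>radial CARD('n))"
proof -
  interpret S: sigma_finite_measure "surface :: (real^'n) measure"
    by (intro finite_measure.axioms(1) finite_measure_surface)
  let ?P = "radial CARD('n) \<Otimes>\<^sub>M (surface :: (real^'n) measure)"
  have m: "(\<lambda>(r, \<omega>). F (r *\<^sub>R \<omega>)) \<in> borel_measurable ?P"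
    by (subst polar_coordinates) simp
  have "(\<integral>\<^sup>+r. (\<integral>\<^sup>+\<omega>. F (r *\<^sub>R \<omega>) \<partial>surface) \<partial>radial CARD('n)) = (\<integral>\<^sup>+p. (\<lambda>(r, \<omega>). F (r *\<^sub>R \<omega>)) p \<partial>?P)"
    using S.nn_integral_fst[OF m] by simp
  also have "\<dots> = (\<integral>\<^sup>+x. F (norm x *\<^sub>R (x /\<^sub>R norm x)) \<partial>restrict_space lborel (-{0}))"
    unfolding polar_coordinates by (subst nn_integral_distr[OF polar_measurable]) auto
  also have "\<dots> = (\<integral>\<^sup>+x. F (norm x *\<^sub>R (x /\<^sub>R norm x)) * indicator (-{0}) x \<partial>lborel)"
    by (intro nn_integral_restrict_space) auto
  also have "\<dots> = (\<integral>\<^sup>+x. F x \<partial>lborel)"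
    using AE_lborel_singleton[of "0::real^'n"] by (intro nn_integral_cong_AE, eventually_elim) auto
  finally show ?thesis ..
qed

lemma integral_polar:
  fixes F :: "real^'n::finite \<Rightarrow> 'b::{banach, second_countable_topology}"
  assumes int: "integrable lborel F"
  shows "integrable (radial CARD('n)) (\<lambda>r. \<integral>\<omega>. F (r *\<^sub>R \<omega>) \<partial>surface)"
    and "(\<integral>x. F x \<partial>lborel) = (\<integral>r. (\<integral>\<omega>. F (r *\<^sub>R \<omega>) \<partial>surface) \<partial>radial CARD('n))"
proof -
  have [measurable]: "F \<in> borel_measurable borel" using int by auto
  interpret S: sigma_finite_measure "surface :: (real^'n) measure"
    by (intro finite_measure.axioms(1) finite_measure_surface)
  interpret N: sigma_finite_measure "radial CARD('n)"
    by (rule sigma_finite_radial) simp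
  interpret P: pair_sigma_finite "radial CARD('n)" "surface :: (real^'n) measure" ..
  let ?P = "radial CARD('n) \<Otimes>\<^sub>M (surface :: (real^'n) measure)"
  let ?G = "\<lambda>(r, \<omega>). F (r *\<^sub>R \<omega>)"
  have ind: "integrable lborel (\<lambda>x. indicator (-{0}) x *\<^sub>R F x)"
    by (intro integrable_mult_indicator int) auto
  have eq: "integrable ?P ?G \<longleftrightarrow> integrable lborel (\<lambda>x. indicator (-{0}) x *\<^sub>R F x)"
    "integral\<^sup>L ?P ?G = (\<integral>x. indicator (-{0}) x *\<^sub>R F x \<partial>lborel)"
    unfolding polar_coordinates
    by (subst integrable_distr_eq[OF polar_measurable] integral_distr[OF polar_measurable], simp,
        subst integrable_restrict_space integral_restrict_space, simp,
        auto intro!: arg_cong[where f="integrable lborel"] arg_cong[where f="integral\<^sup>L lborel"]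
          simp: indicator_def fun_eq_iff)+
  have P: "integrable ?P ?G" using ind eq by simp
  from P.integrable_fst'[OF P] show "integrable (radial CARD('n)) (\<lambda>r. \<integral>\<omega>. F (r *\<^sub>R \<omega>) \<partial>surface)"
    by simp
  have "(\<integral>x. F x \<partial>lborel) = (\<integral>x. indicator (-{0}) x *\<^sub>R F x \<partial>lborel)"
    using AE_lborel_singleton[of "0::real^'n"]
    by (intro integral_cong_AE, measurable, eventually_elim) auto
  with eq P.integral_fst'[OF P] show "(\<integral>x. F x \<partial>lborel) = (\<integral>r. (\<integral>\<omega>. F (r *\<^sub>R \<omega>) \<partial>surface) \<partial>radial CARD('n))"
    by simp
qed

text \<open>With the weight \<open>\<bar>x\<bar>\<^bsup>-n/2\<^esup>\<close> the square has density \<open>\<bar>x\<bar>\<^bsup>-n\<^esup>\<close>, which in polar coordinates is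
  \<open>d\<omega> dr / r\<close>: up to the area of the sphere, a shell counts with its logarithmic thickness \<open>d - c\<close>.\<close>

lemma l2_shell:
  fixes c d :: real
  defines "k \<equiv> \<lambda>x::real^'n::finite. complex_of_real (indicator {x. exp c \<le> norm x \<and> norm x \<le> exp d} x * norm x powr (- (real CARD('n) / 2)))"
  assumes "c \<le> d"
  shows "sq_int k" and "(l2 k)\<^sup>2 = measure (surface :: (real^'n) measure) (sphere 0 1) * (d - c)"
proof -
  let ?n = "CARD('n)" and ?\<sigma> = "surface :: (real^'n) measure"
  let ?S = "measure ?\<sigma> (sphere 0 1)"
  interpret S: finite_measure ?\<sigma> by (rule finite_measure_surface)
  have k[measurable]: "k \<in> borel_measurable borel" unfolding k_def by measurable
  have eS: "emeasure ?\<sigma> (space ?\<sigma>) = ennreal ?S"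
    by (simp add: space_surface S.emeasure_eq_measure)
  have "(\<integral>\<^sup>+x. ennreal ((norm (k x))\<^sup>2) \<partial>lborel)
      = (\<integral>\<^sup>+r. (\<integral>\<^sup>+\<omega>. ennreal ((norm (k (r *\<^sub>R \<omega>)))\<^sup>2) \<partial>?\<sigma>) \<partial>radial ?n)"
    by (rule nn_integral_polar) measurable
  also have "\<dots> = (\<integral>\<^sup>+r. (\<integral>\<^sup>+\<omega>. ennreal ((indicator {exp c..exp d} \<bar>r\<bar> * \<bar>r\<bar> powr (- (real ?n / 2)))\<^sup>2) \<partial>?\<sigma>) \<partial>radial ?n)"
    by (intro nn_integral_cong) (auto simp: k_def space_surface indicator_def norm_mult)
  also have "\<dots> = (\<integral>\<^sup>+r. ennreal ((indicator {exp c..exp d} \<bar>r\<bar> * \<bar>r\<bar> powr (- (real ?n / 2)))\<^sup>2) * ennreal ?S \<partial>radial ?n)"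
    by (simp add: eS)
  also have "\<dots> = (\<integral>\<^sup>+r. ennreal (r ^ (?n - 1)) * indicator {0<..} r
      * (ennreal ((indicator {exp c..exp d} \<bar>r\<bar> * \<bar>r\<bar> powr (- (real ?n / 2)))\<^sup>2) * ennreal ?S) \<partial>lborel)"
    unfolding radial_def by (rule nn_integral_density) measurable
  also have "\<dots> = (\<integral>\<^sup>+r. ennreal ?S * (ennreal (1 / r) * indicator {exp c..exp d} r) \<partial>lborel)"
  proof (intro nn_integral_cong)
    fix r :: real
    show "ennreal (r ^ (?n - 1)) * indicator {0<..} r
      * (ennreal ((indicator {exp c..exp d} \<bar>r\<bar> * \<bar>r\<bar> powr (- (real ?n / 2)))\<^sup>2) * ennreal ?S)
      = ennreal ?S * (ennreal (1 / r) * indicator {exp c..exp d} r)"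
    proof (cases "r \<in> {exp c..exp d}")
      case True
      then have r: "r > 0" using exp_gt_zero[of c] by (simp del: exp_gt_zero)
      have "(r powr (- (real ?n / 2)))\<^sup>2 = r powr (- real ?n)"
        using r by (simp add: power2_eq_square powr_add[symmetric])
      also have "\<dots> = 1 / r ^ ?n" using r by (simp add: powr_minus powr_realpow divide_inverse)
      finally have "r ^ (?n - 1) * (r powr (- (real ?n / 2)))\<^sup>2 = r ^ (?n - 1) / r ^ ?n" by simp
      also have "r ^ ?n = r * r ^ (?n - 1)" using power_minus_mult[of ?n r] by (simp add: mult.commute)
      also have "r ^ (?n - 1) / (r * r ^ (?n - 1)) = 1 / r" using r by simp
      finally have "ennreal (r ^ (?n - 1)) * ennreal ((r powr (- (real ?n / 2)))\<^sup>2) = ennreal (1 / r)"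
        using r by (simp only: ennreal_mult[symmetric] zero_le_power zero_le_power2 less_imp_le)
      moreover have "ennreal (r ^ (?n - 1)) * indicator {0<..} r
        * (ennreal ((indicator {exp c..exp d} \<bar>r\<bar> * \<bar>r\<bar> powr (- (real ?n / 2)))\<^sup>2) * ennreal ?S)
        = (ennreal (r ^ (?n - 1)) * ennreal ((r powr (- (real ?n / 2)))\<^sup>2)) * ennreal ?S"
        using r True by (simp add: mult.assoc)
      ultimately show ?thesis using True by (simp add: mult.commute)
    next
      case False
      then show ?thesis by (auto simp: indicator_def abs_if)
    qed
  qed
  also have "\<dots> = ennreal ?S * (\<integral>\<^sup>+r. ennreal (1 / r) * indicator {exp c..exp d} r \<partial>lborel)"
    by (intro nn_integral_cmult) measurable
  also have "(\<integral>\<^sup>+r. ennreal (1 / r) * indicator {exp c..exp d} r \<partial>lborel) = ennreal (ln (exp d) - ln (exp c))"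
  proof (rule nn_integral_FTC_Icc[where F=ln])
    fix x assume "x \<in> {exp c..exp d}"
    then have x: "x > 0" using exp_gt_zero[of c] by (auto simp del: exp_gt_zero)
    then show "(ln has_real_derivative 1 / x) (at x)" by (auto intro!: derivative_eq_intros)
    show "0 \<le> 1 / x" using x by simp
  qed (use \<open>c \<le> d\<close> in auto)
  finally have "(\<integral>\<^sup>+x. ennreal ((norm (k x))\<^sup>2) \<partial>lborel) = ennreal (?S * (d - c))"
    by (simp add: ennreal_mult')
  then have *: "integrable lborel (\<lambda>x. (norm (k x))\<^sup>2) \<and> (\<integral>x. (norm (k x))\<^sup>2 \<partial>lborel) = ?S * (d - c)"
    using \<open>c \<le> d\<close> by (subst (asm) nn_integral_eq_integrable) auto
  then show "sq_int k" "(l2 k)\<^sup>2 = ?S * (d - c)"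
    using k by (auto simp: sq_int_def l2_square)
qed

text \<open>The unnormalised spherical mean with respect to the uncompleted surface measure. For Borel functions it is a
  Borel function of the radius.\<close>

definition sphere_integral :: "(real^'n::finite \<Rightarrow> complex) \<Rightarrow> real \<Rightarrow> complex" where
  "sphere_integral f r = (\<integral>\<omega>. f (r *\<^sub>R \<omega>) \<partial>surface)"

lemma sphere_integral_measurable [measurable]:
  assumes "f \<in> borel_measurable borel"
  shows "sphere_integral f \<in> borel_measurable borel"
proof -
  interpret S: sigma_finite_measure "surface :: (real^'a) measure"
    by (intro finite_measure.axioms(1) finite_measure_surface)
  have "(\<lambda>(r, \<omega>). f (r *\<^sub>R \<omega>)) \<in> borel_measurable (borel \<Otimes>\<^sub>M (surface :: (real^'a) measure))"
    using measurable_scaleR_polar[OF assms]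
    unfolding measurable_cong_sets[OF sets_pair_measure_cong[OF refl sets_surface] refl] .
  from S.borel_measurable_lebesgue_integral[OF this] show ?thesis
    by (simp add: sphere_integral_def[abs_def])
qed

text \<open>In a completed measure space a function that agrees almost everywhere with a measurable one is
  measurable.\<close>

lemma borel_measurable_completion_AE:
  fixes f g :: "'a \<Rightarrow> 'b::topological_space"
  assumes g: "g \<in> borel_measurable M" and AE: "AE x in M. f x = g x"
  shows "f \<in> borel_measurable (completion M)"
proof (rule borel_measurableI)
  fix U :: "'b set" assume "open U"
  have "AE x in completion M. f x = g x" using AE by (simp add: AE_completion_iff)
  then have "AE x in completion M. x \<in> g -` U \<inter> space M \<longleftrightarrow> x \<in> f -` U \<inter> space M"
    by eventually_elim auto
  then have "f -` U \<inter> space M \<in> sets (completion M)"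
  proof (rule completion.in_sets_AE)
    show "g -` U \<inter> space M \<in> sets (completion M)"
      using measurable_sets[OF g, of U] \<open>open U\<close> by auto
  qed auto
  then show "f -` U \<inter> space (completion M) \<in> sets (completion M)" by simp
qed

text \<open>By polar coordinates a null set meets almost every sphere in a null set, so a Borel version of \<open>f\<close> has the
  same spherical mean at almost every radius.\<close>

lemma spherical_mean_AE:
  fixes f f0 :: "real^'n::finite \<Rightarrow> complex"
  assumes f0[measurable]: "f0 \<in> borel_measurable borel" and AE: "AE x in lborel. f x = f0 x"
  shows "AE r in lborel. r > 0 \<longrightarrow>
    spherical_mean f r = sphere_integral f0 r /\<^sub>R measure (surface :: (real^'n) measure) (sphere 0 1)"
proof -
  let ?\<sigma> = "surface :: (real^'n) measure"
  from AE obtain N where "{x \<in> space lborel. \<not> f x = f0 x} \<subseteq> N" "emeasure lborel N = 0" "N \<in> sets lborel"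
    by (rule AE_E)
  then have N: "N \<in> null_sets lborel" "{x. f x \<noteq> f0 x} \<subseteq> N" by auto
  have Nb[measurable]: "N \<in> sets borel" using N(1) by auto
  interpret S: sigma_finite_measure ?\<sigma>
    by (intro finite_measure.axioms(1) finite_measure_surface)
  have "(\<integral>\<^sup>+r. (\<integral>\<^sup>+\<omega>. indicator N (r *\<^sub>R \<omega>) \<partial>?\<sigma>) \<partial>radial CARD('n)) = (\<integral>\<^sup>+x. indicator N x \<partial>lborel)"
    by (rule nn_integral_polar[symmetric]) measurable
  also have "\<dots> = 0" using N(1) by (simp add: null_setsD1)
  finally have 0: "(\<integral>\<^sup>+r. (\<integral>\<^sup>+\<omega>. indicator N (r *\<^sub>R \<omega>) \<partial>?\<sigma>) \<partial>radial CARD('n)) = 0" .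
  have "(indicator N :: real^'n \<Rightarrow> ennreal) \<in> borel_measurable borel" by measurable
  from measurable_scaleR_polar[OF this]
  have m: "(\<lambda>(r, \<omega>). indicator N (r *\<^sub>R \<omega>) :: ennreal) \<in> borel_measurable (borel \<Otimes>\<^sub>M ?\<sigma>)"
    unfolding measurable_cong_sets[OF sets_pair_measure_cong[OF refl sets_surface] refl] .
  have m': "(\<lambda>r. \<integral>\<^sup>+\<omega>. indicator N (r *\<^sub>R \<omega>) \<partial>?\<sigma>) \<in> borel_measurable borel"
    using S.borel_measurable_nn_integral[OF m] by simp
  have "AE r in radial CARD('n). (\<integral>\<^sup>+\<omega>. indicator N (r *\<^sub>R \<omega>) \<partial>?\<sigma>) = 0"
  proof -
    have "(\<lambda>r. \<integral>\<^sup>+\<omega>. indicator N (r *\<^sub>R \<omega>) \<partial>?\<sigma>) \<in> borel_measurable (radial CARD('n))"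
      using m' unfolding measurable_cong_sets[OF sets_radial refl] .
    from 0[unfolded nn_integral_0_iff_AE[OF this]] show ?thesis .
  qed
  then have "AE r in lborel. 0 < ennreal (r ^ (CARD('n) - 1)) * indicator {0<..} r \<longrightarrow> (\<integral>\<^sup>+\<omega>. indicator N (r *\<^sub>R \<omega>) \<partial>?\<sigma>) = 0"
    unfolding radial_def by (subst (asm) AE_density) simp_all
  then show ?thesis
  proof (eventually_elim, intro impI)
    fix r :: real
    assume "0 < ennreal (r ^ (CARD('n) - 1)) * indicator {0<..} r \<longrightarrow> (\<integral>\<^sup>+\<omega>. indicator N (r *\<^sub>R \<omega>) \<partial>?\<sigma>) = 0"
      and r: "r > 0"
    then have z: "(\<integral>\<^sup>+\<omega>. indicator N (r *\<^sub>R \<omega>) \<partial>?\<sigma>) = 0"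
      by (simp add: ennreal_zero_less_mult_iff)
    have "(\<lambda>\<omega>. indicator N (r *\<^sub>R \<omega>) :: ennreal) \<in> borel_measurable ?\<sigma>"
      by (rule borel_measurable_on_ray) measurable
    from z[unfolded nn_integral_0_iff_AE[OF this]]
    have "AE \<omega> in ?\<sigma>. indicator N (r *\<^sub>R \<omega>) = (0 :: ennreal)" .
    then have ae: "AE \<omega> in ?\<sigma>. f (r *\<^sub>R \<omega>) = f0 (r *\<^sub>R \<omega>)"
    proof eventually_elim
      case (elim \<omega>)
      then have "r *\<^sub>R \<omega> \<notin> N" by (metis indicator_simps(1) zero_neq_one)
      with N(2) show ?case by blast
    qed
    have m0: "(\<lambda>\<omega>. f0 (r *\<^sub>R \<omega>)) \<in> borel_measurable ?\<sigma>" by (rule borel_measurable_on_ray) fact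
    have "(\<integral>\<omega>. f (r *\<^sub>R \<omega>) \<partial>completion ?\<sigma>) = (\<integral>\<omega>. f0 (r *\<^sub>R \<omega>) \<partial>completion ?\<sigma>)"
      by (rule integral_cong_AE[OF borel_measurable_completion_AE[OF m0 ae] measurable_completion[OF m0] AE_completion[OF ae]])
    also have "\<dots> = sphere_integral f0 r"
      by (simp add: sphere_integral_def integral_completion[OF m0])
    finally show "spherical_mean f r = sphere_integral f0 r /\<^sub>R measure ?\<sigma> (sphere 0 1)"
      by (simp add: spherical_mean_def sphere_measure_eq)
  qed
qed

section \<open>Dilating test functions\<close>

lemma norm_diff_from_0_bound:
  fixes F :: "real \<Rightarrow> 'a::real_inner"
  assumes d: "\<And>t. (F has_vector_derivative F' t) (at t)"
    and B: "\<And>t. \<bar>t\<bar> \<le> \<bar>s\<bar> \<Longrightarrow> norm (F' t) \<le> B"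
  shows "norm (F s - F 0) \<le> B * \<bar>s\<bar>"
proof -
  have *: "norm (F b - F a) \<le> B * (b - a)" if "a < b" "\<bar>a\<bar> \<le> \<bar>s\<bar>" "\<bar>b\<bar> \<le> \<bar>s\<bar>" for a b
  proof -
    have "continuous_on {a..b} F"
      by (intro continuous_at_imp_continuous_on ballI has_vector_derivative_continuous[OF d])
    from mvt_general[OF that(1) this d[unfolded has_vector_derivative_def]]
    obtain t where t: "t \<in> {a<..<b}" "norm (F b - F a) \<le> norm ((b - a) *\<^sub>R F' t)" by auto
    have "norm (F' t) \<le> B" using t(1) that by (intro B) auto
    with t(2) that(1) show ?thesis
      by (simp add: mult.commute[of _ "b - a"]) (smt (verit) mult_left_mono)
  qed
  show ?thesis
    using *[of 0 s] *[of s 0] by (cases s "0::real" rule: linorder_cases) (auto simp: norm_minus_commute)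
qed

text \<open>The classical \<open>(x \<cdot> \<nabla>) \<phi>\<close>.\<close>

definition euler :: "(real^'n::finite \<Rightarrow> complex) \<Rightarrow> real^'n \<Rightarrow> complex" where
  "euler \<phi> x = (\<Sum>j\<in>UNIV. of_real (x $ j) * partial_deriv j \<phi> x)"

lemma euler_frechet:
  assumes "test_function \<phi>"
  shows "euler \<phi> x = frechet_derivative \<phi> (at x) x"
proof -
  have d: "(\<phi> has_derivative frechet_derivative \<phi> (at x)) (at x)"
    using test_function_differentiable[OF assms] by (simp add: frechet_derivative_works)
  interpret linear "frechet_derivative \<phi> (at x)"
    by (rule has_derivative_linear[OF d])
  have "x = (\<Sum>j\<in>UNIV. (x $ j) *\<^sub>R axis j 1)"
    by (metis basis_expansion scalar_mult_eq_scaleR)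
  then have "frechet_derivative \<phi> (at x) x = frechet_derivative \<phi> (at x) (\<Sum>j\<in>UNIV. (x $ j) *\<^sub>R axis j 1)"
    by simp
  also have "\<dots> = euler \<phi> x"
    by (simp add: euler_def partial_deriv_def sum scaleR) (simp add: scaleR_conv_of_real)
  finally show ?thesis ..
qed

lemma continuous_euler:
  assumes "test_function \<phi>"
  shows "continuous_on UNIV (euler \<phi>)"
  unfolding euler_def[abs_def]
  by (intro continuous_intros test_function_continuous test_function_partial assms)

lemma partial_deriv_coordinate_mult:
  assumes "test_function \<phi>"
  shows "partial_deriv j (\<lambda>x. of_real (x $ j) * \<phi> x) x = \<phi> x + of_real (x $ j) * partial_deriv j \<phi> x"
proof -
  have d: "(\<phi> has_derivative frechet_derivative \<phi> (at x)) (at x)"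
    using test_function_differentiable[OF assms] by (simp add: frechet_derivative_works)
  have "((\<lambda>x::real^'a. of_real (x $ j) * \<phi> x) has_derivative
      (\<lambda>v. of_real (x $ j) * frechet_derivative \<phi> (at x) v + of_real (v $ j) * \<phi> x)) (at x)"
    by (intro has_derivative_mult d bounded_linear.has_derivative[OF bounded_linear_of_real]
        bounded_linear.has_derivative[OF bounded_linear_vec_nth] has_derivative_ident)
  from frechet_derivative_at[OF this, symmetric] show ?thesis
    by (simp add: partial_deriv_def)
qed

text \<open>Partial derivatives commute with dilations up to a factor, which is why dilations preserve test
  functions.\<close>

lemma partial_deriv_scale:
  fixes \<psi> :: "real^'n::finite \<Rightarrow> complex"
  assumes "\<psi> differentiable_on UNIV"
  shows "partial_deriv j (\<lambda>x. a *\<^sub>R \<psi> (c *\<^sub>R x)) = (\<lambda>x. (a * c) *\<^sub>R partial_deriv j \<psi> (c *\<^sub>R x))"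
proof
  fix x
  have d: "(\<psi> has_derivative frechet_derivative \<psi> (at y)) (at y)" for y
    using assms by (simp add: frechet_derivative_works[symmetric] differentiable_on_def)
  interpret linear "frechet_derivative \<psi> (at (c *\<^sub>R x))"
    by (rule has_derivative_linear[OF d])
  have "((\<lambda>x. a *\<^sub>R \<psi> (c *\<^sub>R x)) has_derivative
      (\<lambda>v. a *\<^sub>R frechet_derivative \<psi> (at (c *\<^sub>R x)) (c *\<^sub>R v))) (at x)"
    by (intro has_derivative_scaleR_right has_derivative_compose[OF _ d] has_derivative_ident)
  from frechet_derivative_at[OF this, symmetric]
  show "partial_deriv j (\<lambda>x. a *\<^sub>R \<psi> (c *\<^sub>R x)) x = (a * c) *\<^sub>R partial_deriv j \<psi> (c *\<^sub>R x)"
    by (simp add: partial_deriv_def scaleR)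
qed

lemma test_function_dil:
  fixes \<phi> :: "real^'n::finite \<Rightarrow> complex"
  assumes "test_function \<phi>"
  shows "test_function (dil s \<phi>)"
  unfolding test_function_def
proof (intro conjI allI)
  fix js
  have diff: "foldr partial_deriv js \<phi> differentiable_on UNIV" for js
    using assms by (simp add: test_function_def)
  define a where "a = exp (real DIM(real^'n) * s / 2)"
  have "foldr partial_deriv js (dil s \<phi>) = (\<lambda>x. (a * exp s ^ length js) *\<^sub>R foldr partial_deriv js \<phi> (exp s *\<^sub>R x))"
  proof (induction js)
    case Nil
    show ?case by (simp add: dil_def[abs_def] a_def)
  next
    case (Cons j js)
    then show ?case by (simp add: partial_deriv_scale[OF diff] ac_simps)
  qed
  moreover have "(\<lambda>x. b *\<^sub>R foldr partial_deriv js \<phi> (exp s *\<^sub>R x)) differentiable_on UNIV" for b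
    unfolding differentiable_on_def
  proof
    fix x
    have D: "(foldr partial_deriv js \<phi> has_derivative frechet_derivative (foldr partial_deriv js \<phi>) (at y)) (at y)" for y
      using diff[of js] by (simp add: frechet_derivative_works[symmetric] differentiable_on_def)
    have "((\<lambda>x. b *\<^sub>R foldr partial_deriv js \<phi> (exp s *\<^sub>R x)) has_derivative
      (\<lambda>v. b *\<^sub>R frechet_derivative (foldr partial_deriv js \<phi>) (at (exp s *\<^sub>R x)) (exp s *\<^sub>R v))) (at x)"
      by (intro has_derivative_scaleR_right has_derivative_compose[OF _ D] has_derivative_ident)
    then show "(\<lambda>x. b *\<^sub>R foldr partial_deriv js \<phi> (exp s *\<^sub>R x)) differentiable (at x)"
      by (rule differentiableI)
  qed
  ultimately show "foldr partial_deriv js (dil s \<phi>) differentiable_on UNIV" by simp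
  obtain r where r: "r > 0" "\<And>x. norm x > r \<Longrightarrow> \<phi> x = 0"
    using test_function_support[OF assms] by blast
  have "{x. dil s \<phi> x \<noteq> 0} \<subseteq> cball 0 (r / exp s)"
  proof
    fix x assume "x \<in> {x. dil s \<phi> x \<noteq> 0}"
    then have "\<not> norm (exp s *\<^sub>R x) > r" using r(2)[of "exp s *\<^sub>R x"] by (auto simp: dil_def)
    then show "x \<in> cball 0 (r / exp s)" by (simp add: field_simps)
  qed
  then show "compact (closure {x. dil s \<phi> x \<noteq> 0})"
    using bounded_subset[OF bounded_cball] by (auto simp: compact_closure)
qed

lemma has_vector_derivative_dil_0:
  fixes \<phi> :: "real^'n::finite \<Rightarrow> complex"
  assumes "test_function \<phi>"
  shows "((\<lambda>s. dil s \<phi> x) has_vector_derivative (real CARD('n) / 2) *\<^sub>R \<phi> x + euler \<phi> x) (at 0)"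
proof -
  have d: "(\<phi> has_derivative frechet_derivative \<phi> (at (exp 0 *\<^sub>R x))) (at (exp 0 *\<^sub>R x))"
    using test_function_differentiable[OF assms] by (simp add: frechet_derivative_works)
  interpret linear "frechet_derivative \<phi> (at x)"
    using has_derivative_linear[OF d] by simp
  have "((\<lambda>s. exp s *\<^sub>R x) has_derivative (\<lambda>h. h *\<^sub>R x)) (at 0)"
    by (auto intro!: derivative_eq_intros)
  from has_derivative_compose[OF this d]
  have "((\<lambda>s. \<phi> (exp s *\<^sub>R x)) has_vector_derivative euler \<phi> x) (at 0)"
    by (simp add: has_vector_derivative_def scaleR euler_frechet[OF assms])
  moreover have "((\<lambda>s. exp (real CARD('n) * s / 2)) has_real_derivative real CARD('n) / 2) (at 0)"
    by (auto intro!: derivative_eq_intros)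
  ultimately have "((\<lambda>s. exp (real CARD('n) * s / 2) *\<^sub>R \<phi> (exp s *\<^sub>R x)) has_vector_derivative
      exp (real CARD('n) * 0 / 2) *\<^sub>R euler \<phi> x + (real CARD('n) / 2) *\<^sub>R \<phi> (exp 0 *\<^sub>R x)) (at 0)"
    by (intro has_vector_derivative_scaleR) auto
  then show ?thesis by (simp add: dil_def add.commute)
qed

text \<open>The derivative at a general time follows from the one at time \<open>0\<close> by the group law.\<close>

lemma has_vector_derivative_dil:
  fixes \<phi> :: "real^'n::finite \<Rightarrow> complex"
  assumes "test_function \<phi>"
  shows "((\<lambda>s. dil s \<phi> x) has_vector_derivative
     dil t (\<lambda>x. (real CARD('n) / 2) *\<^sub>R \<phi> x + euler \<phi> x) x) (at t)"
proof -
  have *: "dil (t + h) \<phi> x = exp (real CARD('n) * t / 2) *\<^sub>R dil h \<phi> (exp t *\<^sub>R x)" for h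
    by (simp add: dil_dil[of t h \<phi>, symmetric, unfolded dil_def[of t]])
  have "((\<lambda>h. exp (real CARD('n) * t / 2) *\<^sub>R dil h \<phi> (exp t *\<^sub>R x)) has_vector_derivative
     dil t (\<lambda>x. (real CARD('n) / 2) *\<^sub>R \<phi> x + euler \<phi> x) x) (at 0)"
    unfolding dil_def[of t]
    using bounded_linear.has_vector_derivative[OF bounded_linear_scaleR_right has_vector_derivative_dil_0[OF assms, of "exp t *\<^sub>R x"]]
    by simp
  then have "((\<lambda>h. dil (t + h) \<phi> x) has_vector_derivative
     dil t (\<lambda>x. (real CARD('n) / 2) *\<^sub>R \<phi> x + euler \<phi> x) x) (at 0)"
    by (simp add: *)
  then show ?thesis
    by (simp add: has_vector_derivative_def has_derivative_at)
qed

section \<open>The generator of the dilations\<close>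

lemma has_vector_derivative_at_0_iff:
  "(F has_vector_derivative D) (at 0) \<longleftrightarrow> ((\<lambda>h. (1 / h) *\<^sub>R (F h - F 0)) \<longlongrightarrow> D) (at 0)"
proof -
  have "norm (F h - F 0 - h *\<^sub>R D) / \<bar>h\<bar> = norm ((1 / h) *\<^sub>R (F h - F 0) - D)" if "h \<noteq> 0" for h
  proof -
    have "(1 / h) *\<^sub>R (F h - F 0) - D = (1 / h) *\<^sub>R (F h - F 0 - h *\<^sub>R D)"
      using that by (simp add: scaleR_diff_right)
    then show ?thesis by (simp add: divide_inverse)
  qed
  then have "((\<lambda>h. norm (F h - F 0 - h *\<^sub>R D) / \<bar>h\<bar>) \<longlongrightarrow> 0) (at 0)
     \<longleftrightarrow> ((\<lambda>h. norm ((1 / h) *\<^sub>R (F h - F 0) - D)) \<longlongrightarrow> 0) (at 0)"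
    by (intro tendsto_cong) (auto simp: eventually_at_filter)
  then show ?thesis
    by (simp add: has_vector_derivative_def has_derivative_at bounded_linear_scaleR_left tendsto_norm_zero_iff
        LIM_zero_iff)
qed

text \<open>Moving \<open>x\<^sub>j\<close> and \<open>\<partial>\<^sub>j\<close> to the test function produces the adjoint \<open>- (n + x \<cdot> \<nabla>)\<close> of \<open>x \<cdot> \<nabla>\<close>.\<close>

lemma is_Lf_weak_form:
  fixes f g :: "real^'n::finite \<Rightarrow> complex"
  assumes f: "sq_int f" and g: "sq_int g" and Lf: "is_Lf f g"
    and \<phi>: "test_function \<phi>"
  shows "(\<integral>x. g x * \<phi> x \<partial>lborel)
      = - (\<integral>x. f x * (of_nat CARD('n) * \<phi> x + euler \<phi> x) \<partial>lborel)"
proof -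
  have [measurable]: "f \<in> borel_measurable borel" "g \<in> borel_measurable borel"
    using f g by (auto simp: sq_int_def)
  have c: "continuous_on UNIV \<phi>" "continuous_on UNIV (partial_deriv j \<phi>)" for j
    using \<phi> by (auto intro: test_function_continuous test_function_partial)
  have [measurable]: "\<phi> \<in> borel_measurable borel" "partial_deriv j \<phi> \<in> borel_measurable borel" for j
    using c by (auto intro: borel_measurable_continuous_onI)
  have [measurable]: "(\<lambda>x::real^'n. x $ j) \<in> borel_measurable borel" for j
    by (intro borel_measurable_continuous_onI continuous_intros)
  obtain r where r: "r > 0" "\<And>x. norm x > r \<Longrightarrow> \<phi> x = 0"
    using test_function_support[OF \<phi>] by blast
  have int: "integrable lborel (\<lambda>x. f x * (\<phi> x + of_real (x $ j) * partial_deriv j \<phi> x))" for j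
  proof -
    obtain r' where r': "r' > 0" "\<And>x. norm x > r' \<Longrightarrow> partial_deriv j \<phi> x = 0"
      using test_function_support[OF test_function_partial[OF \<phi>]] by blast
    have "sq_int (\<lambda>x. \<phi> x + of_real (x $ j) * partial_deriv j \<phi> x)"
      by (rule sq_int_continuous_support[where r="max r r'"])
        (auto intro!: continuous_intros c simp: r(2) r'(2))
    from Cauchy_Schwarz_integral(1)[OF f this] show ?thesis .
  qed
  have "(\<integral>x. g x * \<phi> x \<partial>lborel) = regular_dist g \<phi>"
    by (simp add: regular_dist_def integral_completion)
  also have "\<dots> = dist_L (regular_dist f) \<phi>"
    using Lf \<phi> by (simp add: is_Lf_def)
  also have "\<dots> = - (\<Sum>j\<in>UNIV. \<integral>x. f x * (\<phi> x + of_real (x $ j) * partial_deriv j \<phi> x) \<partial>lborel)"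
    by (simp add: dist_L_def dist_mult_def dist_partial_def regular_dist_def
        partial_deriv_coordinate_mult[OF \<phi>] sum_negf integral_completion)
  also have "(\<Sum>j\<in>UNIV. \<integral>x. f x * (\<phi> x + of_real (x $ j) * partial_deriv j \<phi> x) \<partial>lborel)
     = (\<integral>x. (\<Sum>j\<in>UNIV. f x * (\<phi> x + of_real (x $ j) * partial_deriv j \<phi> x)) \<partial>lborel)"
    by (rule Bochner_Integration.integral_sum[symmetric]) (rule int)
  also have "\<dots> = (\<integral>x. f x * (of_nat CARD('n) * \<phi> x + euler \<phi> x) \<partial>lborel)"
    by (simp add: euler_def sum_distrib_left[symmetric] sum.distrib)
  finally show ?thesis .
qed

text \<open>The function \<open>w\<close> is the derivative of the orbit \<open>s \<mapsto> dil s f\<close> at \<open>s = 0\<close>, in the weak sense. The dilation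
  acts on the test function, where the difference quotients converge boundedly.\<close>

definition dil_generator :: "(real^'n::finite \<Rightarrow> complex) \<Rightarrow> (real^'n \<Rightarrow> complex) \<Rightarrow> bool" where
  "dil_generator f w \<longleftrightarrow> (\<forall>\<phi>. test_function \<phi> \<longrightarrow>
     ((\<lambda>s. \<integral>x. f x * dil (- s) \<phi> x \<partial>lborel) has_vector_derivative (\<integral>x. w x * \<phi> x \<partial>lborel)) (at 0))"

text \<open>The derivative of \<open>dil (- s) \<phi>\<close> at \<open>0\<close> is \<open>- (n / 2) \<phi> - (x \<cdot> \<nabla>) \<phi>\<close>. Paired with \<open>f\<close> it gives
  \<open>\<integral> (g + (n / 2) f) \<phi>\<close> by the weak form of \<open>g = L f\<close>; dominated convergence allows differentiation under the integral.\<close>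

lemma is_Lf_imp_dil_generator:
  fixes f g :: "real^'n::finite \<Rightarrow> complex"
  assumes f: "sq_int f" and g: "sq_int g" and Lf: "is_Lf f g"
  shows "dil_generator f (\<lambda>x. g x + of_nat CARD('n) / 2 * f x)"
  unfolding dil_generator_def
proof (intro allI impI)
  fix \<phi> :: "real^'n \<Rightarrow> complex" assume \<phi>: "test_function \<phi>"
  let ?n = "real CARD('n)"
  define \<psi> where "\<psi> x = (?n / 2) *\<^sub>R \<phi> x + euler \<phi> x" for x
  have [measurable]: "f \<in> borel_measurable borel" "g \<in> borel_measurable borel"
    using f g by (auto simp: sq_int_def)
  have c: "continuous_on UNIV \<phi>" "continuous_on UNIV (euler \<phi>)"
    using \<phi> by (auto intro: test_function_continuous continuous_euler)
  have c\<psi>: "continuous_on UNIV \<psi>"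
    unfolding \<psi>_def[abs_def] by (intro continuous_intros c)
  have [measurable]: "\<phi> \<in> borel_measurable borel" "euler \<phi> \<in> borel_measurable borel" "\<psi> \<in> borel_measurable borel"
    using c c\<psi> by (auto intro: borel_measurable_continuous_onI)
  obtain r where r: "r > 0" "\<And>x. norm x > r \<Longrightarrow> \<phi> x = 0"
    using test_function_support[OF \<phi>] by blast
  have euler0: "euler \<phi> x = 0" if "norm x > r" for x
  proof -
    have "((\<lambda>_. 0) has_derivative (\<lambda>_. 0)) (at x)" by simp
    then have "(\<phi> has_derivative (\<lambda>_. 0)) (at x)"
      by (rule has_derivative_transform_within_open[where s="- cball 0 r"]) (use that r in auto)
    from frechet_derivative_at[OF this] have "frechet_derivative \<phi> (at x) x = 0"
      by (metis (no_types))
    then show ?thesis by (simp add: euler_frechet[OF \<phi>])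
  qed
  have \<psi>0: "\<psi> x = 0" if "norm x > r" for x
    using r(2)[OF that] euler0[OF that] by (simp add: \<psi>_def)
  obtain B where B: "B > 0" "\<And>x. norm (\<psi> x) \<le> B"
    using continuous_bounded_support[OF c\<psi> \<psi>0] by blast
  have s\<phi>: "sq_int \<phi>" by (rule sq_int_test_function[OF \<phi>])
  have se: "sq_int (euler \<phi>)" by (rule sq_int_continuous_support[OF c(2) euler0])
  define q where "q h x = (1 / h) *\<^sub>R (dil (- h) \<phi> x - \<phi> x)" for h x
  have [measurable]: "q h \<in> borel_measurable borel" for h
    unfolding q_def[abs_def] by measurable
  have deriv: "((\<lambda>s. dil (- s) \<phi> x) has_vector_derivative - dil (- s) \<psi> x) (at s)" for s x
  proof -
    have "((\<lambda>s. dil s \<phi> x) has_vector_derivative dil (-s) \<psi> x) (at (- s))"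
      using has_vector_derivative_dil[OF \<phi>, of x "-s"] by (simp add: \<psi>_def[abs_def])
    moreover have "((\<lambda>s::real. - s) has_vector_derivative - 1) (at s)"
      by (auto intro!: derivative_eq_intros)
    ultimately show ?thesis
      using vector_diff_chain_at[of "\<lambda>s. - s" "-1" s "\<lambda>s. dil s \<phi> x" "dil (-s) \<psi> x"]
      by (simp add: o_def)
  qed
  \<comment> \<open>For \<open>\<bar>h\<bar> \<le> 1\<close> the difference quotients have their support in one ball and one common bound; this is
    the dominating function.\<close>
  define K where "K = exp (?n / 2) * B"
  have q_bound: "norm (q h x) \<le> K * indicator (cball 0 (exp 1 * r)) x" if h: "\<bar>h\<bar> \<le> 1" for h x
  proof (cases "norm x \<le> exp 1 * r")
    case True
    have "norm (dil (- h) \<phi> x - dil (- 0) \<phi> x) \<le> K * \<bar>h\<bar>"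
    proof (rule norm_diff_from_0_bound[where F="\<lambda>s. dil (- s) \<phi> x"])
      fix t :: real assume "\<bar>t\<bar> \<le> \<bar>h\<bar>"
      then have t: "- t \<le> 1" using h by linarith
      have "exp (?n * (- t) / 2) \<le> exp (?n / 2)"
        using mult_left_mono[OF t, of ?n] by simp
      then have "exp (?n * (- t) / 2) * norm (\<psi> (exp (- t) *\<^sub>R x)) \<le> K"
        unfolding K_def by (intro mult_mono B) auto
      then show "norm (- dil (- t) \<psi> x) \<le> K" by (simp add: dil_def)
    qed (rule deriv)
    moreover have "norm (q h x) = norm (dil (- h) \<phi> x - dil (- 0) \<phi> x) / \<bar>h\<bar>"
      by (simp add: q_def)
    ultimately show ?thesis using True B(1)
      by (cases "h = 0") (auto simp: K_def pos_divide_le_eq)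
  next
    case False
    have "exp (- h) * norm x > r"
    proof -
      have "exp (- 1) \<le> exp (- h)" using h by simp
      have "r = exp (- 1) * (exp 1 * r)" by (simp add: exp_minus)
      also have "\<dots> < exp (- 1) * norm x" using False by (intro mult_strict_left_mono) auto
      also have "\<dots> \<le> exp (- h) * norm x" using \<open>exp (- 1) \<le> exp (- h)\<close> by (intro mult_right_mono) auto
      finally show ?thesis .
    qed
    moreover have "norm x > r"
    proof -
      have "1 * r \<le> exp 1 * r" using r(1) by (intro mult_right_mono) auto
      with False show ?thesis by linarith
    qed
    ultimately show ?thesis using False r(2)[of x] r(2)[of "exp (- h) *\<^sub>R x"]
      by (simp add: q_def dil_def)
  qed
  have ind: "sq_int (\<lambda>x::real^'n. of_real (K * indicator (cball 0 (exp 1 * r)) x))"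
    by (rule sq_int_bounded_support[where B="\<bar>K\<bar>" and r="exp 1 * r"]) (auto simp: indicator_def)
  have q_lim: "((\<lambda>h. q h x) \<longlongrightarrow> - \<psi> x) (at 0)" for x
    using deriv[of x 0] unfolding has_vector_derivative_at_0_iff by (simp add: q_def)
  have "((\<lambda>h. \<integral>x. f x * q h x \<partial>lborel) \<longlongrightarrow> (\<integral>x. f x * (- \<psi> x) \<partial>lborel)) (at 0)"
    unfolding tendsto_at_iff_sequentially comp_def
  proof (intro allI impI)
    fix X :: "nat \<Rightarrow> real" assume X: "\<forall>i. X i \<in> UNIV - {0}" "X \<longlonglongrightarrow> 0"
    have "\<forall>\<^sub>F k in sequentially. dist (X k) 0 < 1"
      by (rule tendstoD[OF X(2)]) simp
    then obtain m where m': "\<And>k. k \<ge> m \<Longrightarrow> \<bar>X k\<bar> < 1"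
      unfolding eventually_sequentially by auto
    have m: "\<bar>X (k + m)\<bar> \<le> 1" for k using m'[of "k + m"] by simp
    show "(\<lambda>k. \<integral>x. f x * q (X k) x \<partial>lborel) \<longlonglongrightarrow> (\<integral>x. f x * (- \<psi> x) \<partial>lborel)"
      \<comment> \<open>The domination only holds from index \<open>m\<close> on.\<close>
    proof (rule LIMSEQ_offset[of _ m], rule integral_dominated_convergence)
      show "integrable lborel (\<lambda>x. norm (f x) * norm (complex_of_real (K * indicator (cball 0 (exp 1 * r)) x)))"
        by (rule Cauchy_Schwarz_norm(1)[OF f ind])
      have "filterlim (\<lambda>k. X (k + m)) (at 0) sequentially"
        using X LIMSEQ_ignore_initial_segment[OF X(2), of m] by (auto simp: filterlim_at)
      then have "(\<lambda>k. q (X (k + m)) x) \<longlonglongrightarrow> - \<psi> x" for x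
        by (rule filterlim_compose[OF q_lim])
      then show "AE x in lborel. (\<lambda>k. f x * q (X (k + m)) x) \<longlonglongrightarrow> f x * (- \<psi> x)"
        by (intro AE_I2 tendsto_intros)
      show "AE x in lborel. norm (f x * q (X (k + m)) x)
        \<le> norm (f x) * norm (complex_of_real (K * indicator (cball 0 (exp 1 * r)) x))" for k
        unfolding norm_mult norm_of_real using order_trans[OF q_bound[OF m[of k]] abs_ge_self]
        by (intro AE_I2 mult_left_mono) (auto simp del: of_real_mult)
    qed measurable
  qed
  moreover have "(\<integral>x. f x * q h x \<partial>lborel) = (1 / h) *\<^sub>R ((\<integral>x. f x * dil (- h) \<phi> x \<partial>lborel) - (\<integral>x. f x * \<phi> x \<partial>lborel))" for h
  proof -
    have "(\<integral>x. f x * q h x \<partial>lborel) = (\<integral>x. (1 / h) *\<^sub>R (f x * dil (- h) \<phi> x - f x * \<phi> x) \<partial>lborel)"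
      by (simp add: q_def algebra_simps)
    then show ?thesis
      using Bochner_Integration.integral_diff[OF Cauchy_Schwarz_integral(1)[OF f sq_int_dil[OF s\<phi>]] Cauchy_Schwarz_integral(1)[OF f s\<phi>]]
      by simp
  qed
  moreover have "(\<integral>x. f x * (- \<psi> x) \<partial>lborel) = (\<integral>x. (g x + of_nat CARD('n) / 2 * f x) * \<phi> x \<partial>lborel)"
  proof -
    have i: "integrable lborel (\<lambda>x. f x * \<phi> x)" "integrable lborel (\<lambda>x. g x * \<phi> x)" "integrable lborel (\<lambda>x. f x * euler \<phi> x)"
      using f g s\<phi> se by (auto intro: Cauchy_Schwarz_integral)
    have 1: "(\<integral>x. f x * (- \<psi> x) \<partial>lborel) = (\<integral>x. - (of_nat CARD('n) / 2 * (f x * \<phi> x)) - f x * euler \<phi> x \<partial>lborel)"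
      by (intro Bochner_Integration.integral_cong refl) (simp add: \<psi>_def algebra_simps scaleR_conv_of_real)
    have 2: "(\<integral>x. (g x + of_nat CARD('n) / 2 * f x) * \<phi> x \<partial>lborel) = (\<integral>x. g x * \<phi> x + of_nat CARD('n) / 2 * (f x * \<phi> x) \<partial>lborel)"
      by (intro Bochner_Integration.integral_cong refl) (simp add: algebra_simps)
    have 3: "(\<integral>x. f x * (of_nat CARD('n) * \<phi> x + euler \<phi> x) \<partial>lborel) = (\<integral>x. of_nat CARD('n) * (f x * \<phi> x) + f x * euler \<phi> x \<partial>lborel)"
      by (intro Bochner_Integration.integral_cong refl) (simp add: algebra_simps)
    show ?thesis
      unfolding 1 2 using i is_Lf_weak_form[OF f g Lf \<phi>]
      unfolding 3 by simp
  qed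
  ultimately have "((\<lambda>h. (1 / h) *\<^sub>R ((\<integral>x. f x * dil (- h) \<phi> x \<partial>lborel) - (\<integral>x. f x * \<phi> x \<partial>lborel)))
     \<longlongrightarrow> (\<integral>x. (g x + of_nat CARD('n) / 2 * f x) * \<phi> x \<partial>lborel)) (at 0)"
    by simp
  then show "((\<lambda>s. \<integral>x. f x * dil (- s) \<phi> x \<partial>lborel) has_vector_derivative
     (\<integral>x. (g x + of_nat CARD('n) / 2 * f x) * \<phi> x \<partial>lborel)) (at 0)"
    by (simp add: has_vector_derivative_at_0_iff)
qed

lemma integral_dil_diff:
  assumes f: "sq_int f" and \<phi>: "sq_int \<phi>"
  shows "(\<integral>x. f x * dil (- s) \<phi> x \<partial>lborel) - (\<integral>x. f x * dil (- 0) \<phi> x \<partial>lborel)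
    = (\<integral>x. (dil s f x - f x) * \<phi> x \<partial>lborel)"
proof -
  have [measurable]: "f \<in> borel_measurable borel" "\<phi> \<in> borel_measurable borel"
    using f \<phi> by (auto simp: sq_int_def)
  have "(\<integral>x. (dil s f x - f x) * \<phi> x \<partial>lborel) = (\<integral>x. dil s f x * \<phi> x - f x * \<phi> x \<partial>lborel)"
    by (simp add: left_diff_distrib)
  also have "\<dots> = (\<integral>x. dil s f x * \<phi> x \<partial>lborel) - (\<integral>x. f x * \<phi> x \<partial>lborel)"
    by (intro Bochner_Integration.integral_diff Cauchy_Schwarz_integral sq_int_dil f \<phi>)
  also have "(\<integral>x. dil s f x * \<phi> x \<partial>lborel) = (\<integral>x. f x * dil (- s) \<phi> x \<partial>lborel)"
    by (rule integral_dil_mult) auto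
  finally show ?thesis by simp
qed

text \<open>By the group law the weak derivative at time \<open>t\<close> is the pairing of \<open>w\<close> with \<open>dil (- t) \<phi>\<close>, whose norm does
  not depend on \<open>t\<close>. The mean value theorem bounds the increment.\<close>

lemma generator_pairing_bound:
  fixes f w \<phi> :: "real^'n::finite \<Rightarrow> complex"
  assumes f: "sq_int f" and w: "sq_int w" and gen: "dil_generator f w" and \<phi>: "test_function \<phi>"
  shows "norm (\<integral>x. (dil s f x - f x) * \<phi> x \<partial>lborel) \<le> l2 w * l2 \<phi> * \<bar>s\<bar>"
proof -
  have s\<phi>: "sq_int \<phi>" by (rule sq_int_test_function[OF \<phi>])
  define p where "p s = (\<integral>x. f x * dil (- s) \<phi> x \<partial>lborel)" for s
  have "(p has_vector_derivative (\<integral>x. w x * dil (- t) \<phi> x \<partial>lborel)) (at t)" for t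
  proof -
    have "dil (- (t + h)) \<phi> = dil (- h) (dil (- t) \<phi>)" for h
      unfolding dil_dil by (simp add: algebra_simps)
    then have "((\<lambda>h. p (t + h)) has_vector_derivative (\<integral>x. w x * dil (- t) \<phi> x \<partial>lborel)) (at 0)"
      using gen test_function_dil[OF \<phi>, of "-t"] unfolding dil_generator_def p_def by (simp only:)
    then show ?thesis
      by (simp add: has_vector_derivative_def has_derivative_at)
  qed
  then have "norm (p s - p 0) \<le> l2 w * l2 \<phi> * \<bar>s\<bar>"
  proof (rule norm_diff_from_0_bound)
    fix t
    show "norm (\<integral>x. w x * dil (- t) \<phi> x \<partial>lborel) \<le> l2 w * l2 \<phi>"
      using Cauchy_Schwarz_integral(2)[OF w sq_int_dil[OF s\<phi>, of "-t"]] by (simp add: l2_dil[OF s\<phi>])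
  qed
  moreover have "p s - p 0 = (\<integral>x. (dil s f x - f x) * \<phi> x \<partial>lborel)"
    by (rule integral_dil_diff[OF f s\<phi>, folded p_def])
  ultimately show ?thesis by simp
qed

text \<open>Pairing \<open>u\<close> with \<open>cnj u\<close> gives the square of the norm, and \<open>cnj u\<close> is a limit of test functions.\<close>

lemma l2_le_by_duality:
  fixes u :: "real^'n::finite \<Rightarrow> complex"
  assumes u: "sq_int u" and supp: "\<And>x. norm x > r \<Longrightarrow> u x = 0" and K: "K \<ge> 0"
    and dual: "\<And>\<phi>. test_function \<phi> \<Longrightarrow> norm (\<integral>x. u x * \<phi> x \<partial>lborel) \<le> K * l2 \<phi>"
  shows "l2 u \<le> K"
proof -
  have "(l2 u)\<^sup>2 \<le> K * l2 u + \<delta>" if "\<delta> > 0" for \<delta>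
  proof -
    \<comment> \<open>The error terms below add up to \<open>(K + l2 u) * e\<close>.\<close>
    define e where "e = \<delta> / (K + l2 u + 1)"
    have pos: "K + l2 u + 1 > 0" using K l2_nonneg[of u] by linarith
    have "(K + l2 u) * \<delta> \<le> \<delta> * (K + l2 u + 1)" using that by (simp add: algebra_simps)
    then have e: "e > 0" "(K + l2 u) * e \<le> \<delta>"
      using that pos by (simp_all add: e_def pos_divide_le_eq)
    have supp': "cnj (u x) = 0" if "norm x > r" for x using supp[OF that] by simp
    obtain \<phi> where \<phi>: "test_function \<phi>" "l2 (\<lambda>x. cnj (u x) - \<phi> x) < e"
      by (rule test_functions_dense[OF sq_int_cnj[OF u] supp' e(1)])
    have s\<phi>: "sq_int \<phi>" by (rule sq_int_test_function[OF \<phi>(1)])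
    have sd: "sq_int (\<lambda>x. cnj (u x) - \<phi> x)" by (intro sq_int_diff sq_int_cnj u s\<phi>)
    have "l2 \<phi> = l2 (\<lambda>x. cnj (u x) + (- 1) * (cnj (u x) - \<phi> x))" by simp
    also have "\<dots> \<le> l2 (\<lambda>x. cnj (u x)) + l2 (\<lambda>x. (- 1) * (cnj (u x) - \<phi> x))"
      by (intro l2_triangle sq_int_cnj u sq_int_cmult sd)
    also have "\<dots> = l2 u + l2 (\<lambda>x. cnj (u x) - \<phi> x)" unfolding l2_cmult by simp
    finally have l\<phi>: "l2 \<phi> \<le> l2 u + e" using \<phi>(2) by simp
    have "(l2 u)\<^sup>2 = Re (\<integral>x. u x * cnj (u x) \<partial>lborel)"
      by (simp only: l2_square complex_norm_square[symmetric] of_real_power[symmetric]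
          integral_complex_of_real Re_complex_of_real)
    also have "(\<integral>x. u x * cnj (u x) \<partial>lborel) = (\<integral>x. u x * \<phi> x + u x * (cnj (u x) - \<phi> x) \<partial>lborel)"
      by (simp add: algebra_simps)
    also have "\<dots> = (\<integral>x. u x * \<phi> x \<partial>lborel) + (\<integral>x. u x * (cnj (u x) - \<phi> x) \<partial>lborel)"
      by (intro Bochner_Integration.integral_add Cauchy_Schwarz_integral u s\<phi> sd)
    also have "Re \<dots> \<le> norm (\<integral>x. u x * \<phi> x \<partial>lborel) + norm (\<integral>x. u x * (cnj (u x) - \<phi> x) \<partial>lborel)"
      by (rule order_trans[OF complex_Re_le_cmod norm_triangle_ineq])
    also have "\<dots> \<le> K * (l2 u + e) + l2 u * e"
    proof (rule add_mono)
      show "norm (\<integral>x. u x * \<phi> x \<partial>lborel) \<le> K * (l2 u + e)"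
        using dual[OF \<phi>(1)] mult_left_mono[OF l\<phi> K] by linarith
      show "norm (\<integral>x. u x * (cnj (u x) - \<phi> x) \<partial>lborel) \<le> l2 u * e"
        using Cauchy_Schwarz_integral(2)[OF u sd] mult_left_mono[OF less_imp_le[OF \<phi>(2)] l2_nonneg[of u]]
        by linarith
    qed
    finally show ?thesis using e(2) by (simp add: algebra_simps)
  qed
  then have "(l2 u)\<^sup>2 \<le> K * l2 u" by (rule field_le_epsilon)
  then show ?thesis
    using K l2_nonneg[of u] by (cases "l2 u = 0") (auto simp: power2_eq_square)
qed

lemma dil_increment_bound:
  fixes f w :: "real^'n::finite \<Rightarrow> complex"
  assumes f: "sq_int f" and supp: "\<And>x. norm x > r \<Longrightarrow> f x = 0"
    and w: "sq_int w" and gen: "dil_generator f w"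
  shows "l2 (\<lambda>x. dil s f x - f x) \<le> l2 w * \<bar>s\<bar>"
proof (rule l2_le_by_duality)
  show "sq_int (\<lambda>x. dil s f x - f x)" by (intro sq_int_diff sq_int_dil f)
  fix x :: "real^'n" assume x: "norm x > max r (r / exp s)"
  then have "norm (exp s *\<^sub>R x) > r" by (simp add: field_simps)
  with supp x show "dil s f x - f x = 0" by (simp add: dil_def)
next
  fix \<phi> :: "real^'n \<Rightarrow> complex" assume "test_function \<phi>"
  from generator_pairing_bound[OF f w gen this, of s]
  show "norm (\<integral>x. (dil s f x - f x) * \<phi> x \<partial>lborel) \<le> l2 w * \<bar>s\<bar> * l2 \<phi>"
    by (simp add: ac_simps)
qed simp

text \<open>The real part of \<open>\<langle>D\<^sub>s f - f, f\<rangle>\<close> is minus half the square of the increment, hence \<open>O(s\<^sup>2)\<close>, while divided by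
  \<open>s\<close> it converges to \<open>Re \<langle>w, f\<rangle>\<close>. The weak derivative is only known against test functions, so \<open>cnj f\<close> is approximated
  by one.\<close>

lemma generator_skew:
  fixes f w :: "real^'n::finite \<Rightarrow> complex"
  assumes f: "sq_int f" and supp: "\<And>x. norm x > r \<Longrightarrow> f x = 0"
    and w: "sq_int w" and gen: "dil_generator f w"
  shows "Re (\<integral>x. w x * cnj (f x) \<partial>lborel) = 0"
proof -
  define q where "q s = (\<integral>x. (dil s f x - f x) * cnj (f x) \<partial>lborel)" for s
  have u: "sq_int (\<lambda>x. dil s f x - f x)" for s by (intro sq_int_diff sq_int_dil f)
  have q: "\<bar>Re (q s)\<bar> \<le> (l2 w * \<bar>s\<bar>)\<^sup>2 / 2" for s
  proof -
    \<comment> \<open>Unitarity: expanding \<open>\<parallel>D\<^sub>s f\<parallel>\<^sup>2 = \<parallel>f\<parallel>\<^sup>2\<close> around \<open>f\<close> expresses \<open>Re (q s)\<close> by the square of the increment.\<close>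
    have "(l2 f)\<^sup>2 = (l2 (\<lambda>x. (dil s f x - f x) + f x))\<^sup>2"
      using l2_dil[OF f, of s] by simp
    also have "\<dots> = (l2 (\<lambda>x. dil s f x - f x))\<^sup>2 + 2 * Re (q s) + (l2 f)\<^sup>2"
      unfolding q_def by (rule l2_square_add[OF u f])
    finally have "\<bar>Re (q s)\<bar> = (l2 (\<lambda>x. dil s f x - f x))\<^sup>2 / 2"
      using zero_le_power2[of "l2 (\<lambda>x. dil s f x - f x)"] by linarith
    moreover have "(l2 (\<lambda>x. dil s f x - f x))\<^sup>2 \<le> (l2 w * \<bar>s\<bar>)\<^sup>2"
      by (intro power_mono dil_increment_bound[OF f supp w gen] l2_nonneg)
    ultimately show ?thesis by simp
  qed
  have supp': "cnj (f x) = 0" if "norm x > r" for x using supp[OF that] by simp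
  have "\<bar>Re (\<integral>x. w x * cnj (f x) \<partial>lborel)\<bar> \<le> 0 + \<delta>" if "\<delta> > 0" for \<delta>
  proof -
    \<comment> \<open>Replacing \<open>cnj f\<close> by a test function \<open>\<phi>\<close> costs \<open>l2 w * e\<close> twice: in the difference quotient, where
      \<open>dil_increment_bound\<close> makes the cost uniform in \<open>s\<close>, and in the limit.\<close>
    define e where "e = \<delta> / (2 * l2 w + 1)"
    have pos: "2 * l2 w + 1 > 0" using l2_nonneg[of w] by linarith
    have "2 * l2 w * \<delta> \<le> \<delta> * (2 * l2 w + 1)" using that by (simp add: algebra_simps)
    then have e: "e > 0" "2 * l2 w * e \<le> \<delta>"
      using that pos by (simp_all add: e_def pos_divide_le_eq)
    obtain \<phi> where \<phi>: "test_function \<phi>" "l2 (\<lambda>x. cnj (f x) - \<phi> x) < e"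
      by (rule test_functions_dense[OF sq_int_cnj[OF f] supp' e(1)])
    have s\<phi>: "sq_int \<phi>" by (rule sq_int_test_function[OF \<phi>(1)])
    have sd: "sq_int (\<lambda>x. cnj (f x) - \<phi> x)" by (intro sq_int_diff sq_int_cnj f s\<phi>)
    define p where "p s = (\<integral>x. f x * dil (- s) \<phi> x \<partial>lborel)" for s
    have "(p has_vector_derivative (\<integral>x. w x * \<phi> x \<partial>lborel)) (at 0)"
      using gen \<phi>(1) unfolding dil_generator_def p_def[abs_def] by blast
    then have "((\<lambda>s. (1 / s) *\<^sub>R (p s - p 0)) \<longlongrightarrow> (\<integral>x. w x * \<phi> x \<partial>lborel)) (at_right 0)"
      unfolding has_vector_derivative_at_0_iff by (rule filterlim_mono) (auto simp: at_le)
    then have lim: "((\<lambda>s. \<bar>Re ((1 / s) *\<^sub>R (p s - p 0))\<bar>) \<longlongrightarrow> \<bar>Re (\<integral>x. w x * \<phi> x \<partial>lborel)\<bar>) (at_right 0)"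
      by (intro tendsto_intros)
    have bound: "\<bar>Re ((1 / s) *\<^sub>R (p s - p 0))\<bar> \<le> (l2 w)\<^sup>2 / 2 * s + l2 w * e" if "s > 0" for s
    proof -
      have pp: "p s - p 0 = (\<integral>x. (dil s f x - f x) * \<phi> x \<partial>lborel)"
        by (rule integral_dil_diff[OF f s\<phi>, folded p_def])
      have "q s = (\<integral>x. (dil s f x - f x) * \<phi> x + (dil s f x - f x) * (cnj (f x) - \<phi> x) \<partial>lborel)"
        by (simp add: q_def algebra_simps)
      also have "\<dots> = p s - p 0 + (\<integral>x. (dil s f x - f x) * (cnj (f x) - \<phi> x) \<partial>lborel)"
        unfolding pp by (intro Bochner_Integration.integral_add Cauchy_Schwarz_integral u s\<phi> sd)
      finally have "p s - p 0 = q s - (\<integral>x. (dil s f x - f x) * (cnj (f x) - \<phi> x) \<partial>lborel)" by simp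
      then have "\<bar>Re (p s - p 0)\<bar> \<le> \<bar>Re (q s)\<bar> + norm (\<integral>x. (dil s f x - f x) * (cnj (f x) - \<phi> x) \<partial>lborel)"
        using abs_Re_le_cmod[of "\<integral>x. (dil s f x - f x) * (cnj (f x) - \<phi> x) \<partial>lborel"] by simp
      also have "\<dots> \<le> (l2 w * \<bar>s\<bar>)\<^sup>2 / 2 + (l2 w * \<bar>s\<bar>) * e"
      proof (intro add_mono q)
        have "norm (\<integral>x. (dil s f x - f x) * (cnj (f x) - \<phi> x) \<partial>lborel) \<le> l2 (\<lambda>x. dil s f x - f x) * l2 (\<lambda>x. cnj (f x) - \<phi> x)"
          by (rule Cauchy_Schwarz_integral[OF u sd])
        also have "\<dots> \<le> (l2 w * \<bar>s\<bar>) * e"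
          using \<phi>(2) by (intro mult_mono dil_increment_bound[OF f supp w gen]) auto
        finally show "norm (\<integral>x. (dil s f x - f x) * (cnj (f x) - \<phi> x) \<partial>lborel) \<le> (l2 w * \<bar>s\<bar>) * e" .
      qed
      finally show ?thesis using that by (simp add: field_simps power2_eq_square)
    qed
    have "((\<lambda>s. (l2 w)\<^sup>2 / 2 * s + l2 w * e) \<longlongrightarrow> (l2 w)\<^sup>2 / 2 * 0 + l2 w * e) (at_right 0)"
      by (intro tendsto_intros)
    from tendsto_le[OF _ this lim] have "\<bar>Re (\<integral>x. w x * \<phi> x \<partial>lborel)\<bar> \<le> l2 w * e"
      using bound by (auto simp: eventually_at_filter)
    moreover have "(\<integral>x. w x * cnj (f x) \<partial>lborel) = (\<integral>x. w x * \<phi> x \<partial>lborel) + (\<integral>x. w x * (cnj (f x) - \<phi> x) \<partial>lborel)"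
    proof -
      have "(\<integral>x. w x * cnj (f x) \<partial>lborel) = (\<integral>x. w x * \<phi> x + w x * (cnj (f x) - \<phi> x) \<partial>lborel)"
        by (simp add: algebra_simps)
      also have "\<dots> = (\<integral>x. w x * \<phi> x \<partial>lborel) + (\<integral>x. w x * (cnj (f x) - \<phi> x) \<partial>lborel)"
        by (intro Bochner_Integration.integral_add Cauchy_Schwarz_integral w s\<phi> sd)
      finally show ?thesis .
    qed
    moreover have "\<bar>Re (\<integral>x. w x * (cnj (f x) - \<phi> x) \<partial>lborel)\<bar> \<le> l2 w * e"
      using order_trans[OF abs_Re_le_cmod Cauchy_Schwarz_integral(2)[OF w sd]]
        mult_left_mono[OF less_imp_le[OF \<phi>(2)] l2_nonneg[of w]] by linarith
    ultimately show ?thesis using e(2) by (simp only: plus_complex.sel)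
  qed
  then have "\<bar>Re (\<integral>x. w x * cnj (f x) \<partial>lborel)\<bar> \<le> 0" by (rule field_le_epsilon)
  then show ?thesis by simp
qed

text \<open>Expanding \<open>g = w - (n / 2) f\<close>, the mixed term vanishes by skewness.\<close>

theorem l2_generator_square:
  fixes f g :: "real^'n::finite \<Rightarrow> complex"
  assumes f: "sq_int f" and supp: "\<And>x. norm x > r \<Longrightarrow> f x = 0" and g: "sq_int g" and Lf: "is_Lf f g"
  shows "(l2 (\<lambda>x. g x + of_nat CARD('n) / 2 * f x))\<^sup>2 = (l2 g)\<^sup>2 - (real CARD('n))\<^sup>2 / 4 * (l2 f)\<^sup>2"
proof -
  let ?c = "of_nat CARD('n) / 2 :: complex"
  let ?w = "\<lambda>x. g x + ?c * f x"
  have w: "sq_int ?w" by (intro sq_int_add g sq_int_cmult f)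
  have skew: "Re (\<integral>x. ?w x * cnj (f x) \<partial>lborel) = 0"
    by (rule generator_skew[OF f supp w is_Lf_imp_dil_generator[OF f g Lf]])
  have c: "sq_int (\<lambda>x. (- ?c) * f x)" by (rule sq_int_cmult[OF f])
  have "(l2 g)\<^sup>2 = (l2 (\<lambda>x. ?w x + (- ?c) * f x))\<^sup>2" by simp
  also have "\<dots> = (l2 ?w)\<^sup>2 + 2 * Re (\<integral>x. ?w x * cnj ((- ?c) * f x) \<partial>lborel) + (l2 (\<lambda>x. (- ?c) * f x))\<^sup>2"
    by (rule l2_square_add[OF w c])
  also have "(\<integral>x. ?w x * cnj ((- ?c) * f x) \<partial>lborel) = (\<integral>x. (- ?c) * (?w x * cnj (f x)) \<partial>lborel)"
    by (intro Bochner_Integration.integral_cong refl) (simp add: algebra_simps)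
  also have "\<dots> = (- ?c) * (\<integral>x. ?w x * cnj (f x) \<partial>lborel)" by simp
  also have "Re \<dots> = 0" using skew by simp
  finally show ?thesis
    unfolding l2_cmult by (simp add: power_mult_distrib norm_divide power2_eq_square)
qed

section \<open>Weighted integrals over balls\<close>

text \<open>In logarithmic radial coordinates this is the integral of \<open>exp (n t / 2)\<close> times the sphere integral of \<open>f\<close> over
  \<open>t < ln \<rho>\<close>.\<close>

definition ball_integral :: "(real^'n::finite \<Rightarrow> complex) \<Rightarrow> real \<Rightarrow> complex" where
  "ball_integral f \<rho> = (\<integral>x. of_real (indicator {x. norm x < \<rho>} x * norm x powr (- (real CARD('n) / 2))) * f x \<partial>lborel)"

text \<open>The weight is homogeneous of the degree for which scaling the radius is a unitary dilation of \<open>f\<close>.\<close>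

lemma ball_integral_scale:
  fixes f :: "real^'n::finite \<Rightarrow> complex"
  assumes [measurable]: "f \<in> borel_measurable borel"
  shows "ball_integral f (\<rho> * exp \<epsilon>) = ball_integral (dil \<epsilon> f) \<rho>"
proof -
  let ?n = "real CARD('n)"
  let ?F = "\<lambda>x. of_real (indicator {x. norm x < \<rho> * exp \<epsilon>} x * norm x powr (- (?n / 2))) * f x"
  have "?F \<in> borel_measurable borel" by measurable
  from integral_scale[OF exp_gt_zero this, of \<epsilon>]
  have "ball_integral f (\<rho> * exp \<epsilon>) = exp \<epsilon> ^ CARD('n) *\<^sub>R (\<integral>x. ?F (exp \<epsilon> *\<^sub>R x) \<partial>lborel)"
    by (simp only: ball_integral_def DIM_cart DIM_real mult_1_right)
  also have "\<dots> = (\<integral>x. exp \<epsilon> ^ CARD('n) *\<^sub>R (of_real (indicator {x. norm x < \<rho> * exp \<epsilon>} (exp \<epsilon> *\<^sub>R x)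
      * norm (exp \<epsilon> *\<^sub>R x) powr (- (?n / 2))) * f (exp \<epsilon> *\<^sub>R x)) \<partial>lborel)"
    by simp
  also have "\<dots> = ball_integral (dil \<epsilon> f) \<rho>"
    unfolding ball_integral_def
  proof (intro Bochner_Integration.integral_cong refl)
    fix x :: "real^'n"
    have "exp \<epsilon> ^ CARD('n) * exp \<epsilon> powr (- (?n / 2)) = exp (?n * \<epsilon> + - (?n / 2) * \<epsilon>)"
      by (simp only: exp_add exp_of_nat_mult powr_def ln_exp exp_not_eq_zero if_False)
    also have "?n * \<epsilon> + - (?n / 2) * \<epsilon> = ?n * \<epsilon> / 2" by (simp add: field_simps)
    finally have "exp \<epsilon> ^ CARD('n) * exp \<epsilon> powr (- (?n / 2)) = exp (?n * \<epsilon> / 2)" .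
    moreover have "(exp \<epsilon> * norm x) powr (- (?n / 2)) = exp \<epsilon> powr (- (?n / 2)) * norm x powr (- (?n / 2))"
      by (simp add: powr_mult)
    ultimately have "exp \<epsilon> ^ CARD('n) * (exp \<epsilon> * norm x) powr (- (?n / 2)) = exp (?n * \<epsilon> / 2) * norm x powr (- (?n / 2))"
      by simp
    then have E: "exp \<epsilon> ^ CARD('n) * norm (exp \<epsilon> *\<^sub>R x) powr (- (?n / 2)) = exp (?n * \<epsilon> / 2) * norm x powr (- (?n / 2))"
      by simp
    have I: "indicat_real {x. norm x < \<rho> * exp \<epsilon>} (exp \<epsilon> *\<^sub>R x) = indicator {x. norm x < \<rho>} x"
      by (simp add: indicator_def mult.commute)
    have "exp \<epsilon> ^ CARD('n) *\<^sub>R (of_real (indicator {x. norm x < \<rho> * exp \<epsilon>} (exp \<epsilon> *\<^sub>R x)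
      * norm (exp \<epsilon> *\<^sub>R x) powr (- (?n / 2))) * f (exp \<epsilon> *\<^sub>R x))
      = of_real (indicator {x. norm x < \<rho>} x * (exp \<epsilon> ^ CARD('n) * norm (exp \<epsilon> *\<^sub>R x) powr (- (?n / 2)))) * f (exp \<epsilon> *\<^sub>R x)"
      unfolding I by (simp only: scaleR_conv_of_real of_real_mult mult.assoc mult.left_commute)
    also have "\<dots> = of_real (indicator {x. norm x < \<rho>} x * norm x powr (- (?n / 2))) * dil \<epsilon> f x"
      unfolding E dil_def
      by (simp only: scaleR_conv_of_real of_real_mult mult.assoc mult.left_commute DIM_cart DIM_real mult_1_right)
    finally show "exp \<epsilon> ^ CARD('n) *\<^sub>R (of_real (indicator {x. norm x < \<rho> * exp \<epsilon>} (exp \<epsilon> *\<^sub>R x)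
      * norm (exp \<epsilon> *\<^sub>R x) powr (- (?n / 2))) * f (exp \<epsilon> *\<^sub>R x))
      = of_real (indicator {x. norm x < \<rho>} x * norm x powr (- (?n / 2))) * dil \<epsilon> f x" .
  qed
  finally show ?thesis .
qed

text \<open>Cauchy-Schwarz against the weight on the shell that contains the support of \<open>f\<close>.\<close>

lemma ball_integral_bound:
  fixes f :: "real^'n::finite \<Rightarrow> complex"
  assumes f: "sq_int f" and supp: "\<And>x. f x \<noteq> 0 \<Longrightarrow> exp c \<le> norm x \<and> norm x \<le> exp d" and "c \<le> d"
  shows "integrable lborel (\<lambda>x. of_real (indicator {x. norm x < \<rho>} x * norm x powr (- (real CARD('n) / 2))) * f x)"
    and "norm (ball_integral f \<rho>) \<le> sqrt (measure (surface :: (real^'n) measure) (sphere 0 1) * (d - c)) * l2 f"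
proof -
  let ?k = "\<lambda>x::real^'n. complex_of_real (indicator {x. exp c \<le> norm x \<and> norm x \<le> exp d} x * norm x powr (- (real CARD('n) / 2)))"
  let ?S = "measure (surface :: (real^'n) measure) (sphere 0 1)"
  note k = l2_shell[OF \<open>c \<le> d\<close>, where 'n='n]
  have [measurable]: "f \<in> borel_measurable borel" using f by (simp add: sq_int_def)
  let ?g = "\<lambda>x. of_real (indicator {x. norm x < \<rho>} x) * f x"
  have g: "sq_int ?g" by (rule sq_int_bound[OF f]) (auto simp: indicator_def)
  have eq: "of_real (indicator {x. norm x < \<rho>} x * norm x powr (- (real CARD('n) / 2))) * f x = ?k x * ?g x" for x
    using supp[of x] by (cases "f x = 0") (auto simp: indicator_def)
  show "integrable lborel (\<lambda>x. of_real (indicator {x. norm x < \<rho>} x * norm x powr (- (real CARD('n) / 2))) * f x)"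
    unfolding eq by (rule Cauchy_Schwarz_integral(1)[OF k(1) g])
  have "norm (ball_integral f \<rho>) \<le> l2 ?k * l2 ?g"
    unfolding ball_integral_def eq by (rule Cauchy_Schwarz_integral(2)[OF k(1) g])
  also have "l2 ?k = sqrt (?S * (d - c))"
    by (rule real_sqrt_unique[OF k(2) l2_nonneg, symmetric])
  also have "sqrt (?S * (d - c)) * l2 ?g \<le> sqrt (?S * (d - c)) * l2 f"
    using \<open>c \<le> d\<close> by (intro mult_left_mono l2_mono g f) (auto simp: indicator_def)
  finally show "norm (ball_integral f \<rho>) \<le> sqrt (?S * (d - c)) * l2 f" .
qed

text \<open>An increment in the radius is the ball integral of \<open>dil \<epsilon> f - f\<close>. The factor \<open>\<epsilon>\<close> comes from the increment of
  the orbit, the square root from the logarithmic thickness \<open>2 a + \<epsilon>\<close> of the support. Dividing by \<open>\<epsilon>\<close> and letting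
  \<open>\<epsilon>\<close> tend to \<open>0\<close> will bound the integrand itself, without any derivative of \<open>f\<close>.\<close>

lemma ball_integral_increment:
  fixes f w :: "real^'n::finite \<Rightarrow> complex"
  assumes f: "sq_int f" and supp: "\<And>x. f x \<noteq> 0 \<Longrightarrow> exp (- a) \<le> norm x \<and> norm x \<le> exp a" and "a > 0"
    and w: "sq_int w" and gen: "dil_generator f w" and "\<epsilon> \<ge> 0"
  shows "norm (ball_integral f (\<rho> * exp \<epsilon>) - ball_integral f \<rho>)
    \<le> sqrt (measure (surface :: (real^'n) measure) (sphere 0 1) * (2 * a + \<epsilon>)) * l2 w * \<epsilon>"
proof -
  let ?S = "measure (surface :: (real^'n) measure) (sphere 0 1)"
  have [measurable]: "f \<in> borel_measurable borel" using f by (simp add: sq_int_def)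
  have le: "- a - \<epsilon> \<le> a" using assms by linarith
  \<comment> \<open>In logarithmic coordinates the supports of \<open>f\<close> and \<open>dil \<epsilon> f\<close> are contained in \<open>[- a, a]\<close> and
    \<open>[- a - \<epsilon>, a - \<epsilon>]\<close>.\<close>
  have supp1: "exp (- a - \<epsilon>) \<le> norm x \<and> norm x \<le> exp a" if "f x \<noteq> 0" for x
    using supp[OF that] \<open>\<epsilon> \<ge> 0\<close> order_trans[of "exp (- a - \<epsilon>)" "exp (- a)" "norm x"] by auto
  have supp2: "exp (- a - \<epsilon>) \<le> norm x \<and> norm x \<le> exp a" if "dil \<epsilon> f x \<noteq> 0" for x
  proof -
    have *: "exp (- a) \<le> exp \<epsilon> * norm x \<and> exp \<epsilon> * norm x \<le> exp a"
      using supp[of "exp \<epsilon> *\<^sub>R x"] that by (auto simp: dil_def)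
    have "1 * norm x \<le> exp \<epsilon> * norm x" using \<open>\<epsilon> \<ge> 0\<close> by (intro mult_right_mono) auto
    moreover have "exp (- a - \<epsilon>) \<le> norm x"
      using * unfolding exp_diff by (simp add: pos_divide_le_eq mult.commute)
    ultimately show ?thesis using * by linarith
  qed
  let ?u = "\<lambda>x. dil \<epsilon> f x - f x"
  have u: "sq_int ?u" by (intro sq_int_diff sq_int_dil f)
  have suppu: "exp (- a - \<epsilon>) \<le> norm x \<and> norm x \<le> exp a" if "?u x \<noteq> 0" for x
    using supp1[of x] supp2[of x] that by (cases "f x = 0") auto
  have "ball_integral f (\<rho> * exp \<epsilon>) - ball_integral f \<rho> = ball_integral (dil \<epsilon> f) \<rho> - ball_integral f \<rho>"
    by (simp add: ball_integral_scale)
  also have "\<dots> = ball_integral ?u \<rho>"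
    unfolding ball_integral_def right_diff_distrib
    by (rule Bochner_Integration.integral_diff[OF ball_integral_bound(1)[OF sq_int_dil[OF f] supp2 le]
          ball_integral_bound(1)[OF f supp1 le], symmetric])
  also have "norm (ball_integral ?u \<rho>) \<le> sqrt (?S * (a - (- a - \<epsilon>))) * l2 ?u"
    by (rule ball_integral_bound(2)[OF u suppu le])
  also have "a - (- a - \<epsilon>) = 2 * a + \<epsilon>" by simp
  also have "sqrt (?S * (2 * a + \<epsilon>)) * l2 ?u \<le> sqrt (?S * (2 * a + \<epsilon>)) * (l2 w * \<epsilon>)"
  proof (intro mult_left_mono)
    have "f x = 0" if "norm x > exp a" for x using supp[of x] that by force
    then have "l2 ?u \<le> l2 w * \<bar>\<epsilon>\<bar>" by (rule dil_increment_bound[OF f _ w gen])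
    then show "l2 ?u \<le> l2 w * \<epsilon>" using \<open>\<epsilon> \<ge> 0\<close> by simp
  qed (use assms in auto)
  finally show ?thesis by (simp add: mult.assoc)
qed

text \<open>The derivative of \<^term>\<open>ball_integral f\<close> with respect to the radius.\<close>

definition radial_density :: "(real^'n::finite \<Rightarrow> complex) \<Rightarrow> real \<Rightarrow> complex" where
  "radial_density f r = (indicator {0<..} r * r ^ (CARD('n) - 1) * r powr (- (real CARD('n) / 2))) *\<^sub>R sphere_integral f r"

lemma ball_integral_polar:
  fixes f :: "real^'n::finite \<Rightarrow> complex"
  assumes f: "sq_int f" and supp: "\<And>x. f x \<noteq> 0 \<Longrightarrow> exp c \<le> norm x \<and> norm x \<le> exp d" and "c \<le> d"
  shows "integrable lborel (\<lambda>r. indicator {..<\<rho>} r *\<^sub>R radial_density f r)"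
    and "ball_integral f \<rho> = (\<integral>r. indicator {..<\<rho>} r *\<^sub>R radial_density f r \<partial>lborel)"
proof -
  have [measurable]: "f \<in> borel_measurable borel" using f by (simp add: sq_int_def)
  let ?n = "CARD('n)"
  let ?F = "\<lambda>x. of_real (indicator {x. norm x < \<rho>} x * norm x powr (- (real ?n / 2))) * f x"
  have radial: "radial ?n = density lborel (\<lambda>r. ennreal (indicator {0<..} r * r ^ (?n - 1)))"
    unfolding radial_def by (intro arg_cong[where f="density lborel"]) (auto simp: indicator_def)
  have nn: "AE r in lborel. 0 \<le> indicat_real {0<..} r * r ^ (?n - 1)"
    by (intro AE_I2) (simp add: indicator_def)
  have eq: "(indicat_real {0<..} r * r ^ (?n - 1)) *\<^sub>R (\<integral>\<omega>. ?F (r *\<^sub>R \<omega>) \<partial>surface) = indicator {..<\<rho>} r *\<^sub>R radial_density f r" for r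
  proof (cases "r > 0")
    case True
    have "(\<integral>\<omega>. ?F (r *\<^sub>R \<omega>) \<partial>surface) = (\<integral>\<omega>. of_real (indicator {..<\<rho>} r * r powr (- (real ?n / 2))) * f (r *\<^sub>R \<omega>) \<partial>surface)"
      using True by (intro Bochner_Integration.integral_cong refl) (simp add: space_surface indicator_def)
    also have "\<dots> = of_real (indicator {..<\<rho>} r * r powr (- (real ?n / 2))) * sphere_integral f r"
      by (simp add: sphere_integral_def)
    finally show ?thesis using True by (simp add: radial_density_def scaleR_conv_of_real)
  qed (simp add: radial_density_def)
  have m: "(\<lambda>r. \<integral>\<omega>. ?F (r *\<^sub>R \<omega>) \<partial>surface) \<in> borel_measurable borel"
  proof -
    have "?F \<in> borel_measurable borel" by measurable
    from sphere_integral_measurable[OF this] show ?thesis unfolding sphere_integral_def[abs_def] .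
  qed
  have "integrable lborel ?F" by (rule ball_integral_bound(1)[OF f supp \<open>c \<le> d\<close>])
  note P = integral_polar[OF this]
  show "integrable lborel (\<lambda>r. indicator {..<\<rho>} r *\<^sub>R radial_density f r)"
    using P(1) m nn unfolding radial eq[symmetric] by (subst (asm) integrable_density) auto
  show "ball_integral f \<rho> = (\<integral>r. indicator {..<\<rho>} r *\<^sub>R radial_density f r \<partial>lborel)"
    unfolding eq[symmetric] ball_integral_def P(2)
    using m nn unfolding radial by (subst integral_density) auto
qed

section \<open>Pointwise bound for the spherical mean\<close>

text \<open>By Lebesgue's differentiation theorem the density is almost everywhere the limit of
  difference quotients of the ball integral, and these are bounded by \<open>ball_integral_increment\<close>. The factor \<open>1 / r\<close>
  is the derivative of \<open>ln r\<close>.\<close>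

lemma radial_density_bound:
  fixes f w :: "real^'n::finite \<Rightarrow> complex"
  assumes f: "sq_int f" and supp: "\<And>x. f x \<noteq> 0 \<Longrightarrow> exp (- a) \<le> norm x \<and> norm x \<le> exp a" and a: "a > 0"
    and w: "sq_int w" and gen: "dil_generator f w"
  shows "AE r in lborel. r > 0 \<longrightarrow>
    norm (radial_density f r) \<le> sqrt (measure (surface :: (real^'n) measure) (sphere 0 1) * (2 * a)) * l2 w / r"
proof -
  let ?S = "measure (surface :: (real^'n) measure) (sphere 0 1)"
  let ?H = "radial_density f"
  have le: "- a \<le> a" using a by simp
  have intH: "integrable lborel (\<lambda>r. indicator {..<\<rho>} r *\<^sub>R ?H r)" for \<rho>
    by (rule ball_integral_polar(1)[OF f supp le])
  have ballH: "ball_integral f \<rho> = (\<integral>r. indicator {..<\<rho>} r *\<^sub>R ?H r \<partial>lborel)" for \<rho>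
    by (rule ball_integral_polar(2)[OF f supp le])
  have set: "set_integrable lborel {x..y} ?H" for x y
  proof -
    have "integrable lborel (\<lambda>r. indicator {x..y} r *\<^sub>R (indicator {..<y + 1} r *\<^sub>R ?H r))"
      by (intro integrable_mult_indicator intH) auto
    moreover have "indicator {x..y} r *\<^sub>R (indicator {..<y + 1} r *\<^sub>R ?H r) = indicator {x..y} r *\<^sub>R ?H r" for r
      by (auto simp: indicator_def)
    ultimately show ?thesis unfolding set_integrable_def by (simp only:)
  qed
  have int: "?H integrable_on cbox x y" for x y
    using set_borel_integral_eq_integral(1)[OF set[of x y]] by simp
  have "\<exists>N. negligible N \<and> (\<forall>x e. x \<notin> N \<longrightarrow> 0 < e \<longrightarrow>
      (\<exists>d>0. \<forall>h. 0 < h \<and> h < d \<longrightarrow> norm (integral (cbox x (x + h *\<^sub>R One)) ?H /\<^sub>R h ^ DIM(real) - ?H x) < e))"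
  proof (rule integrable_ccontinuous_explicit[of ?H, OF int])
    fix N :: "real set"
    assume "negligible N" "\<And>x e. x \<notin> N \<Longrightarrow> 0 < e \<Longrightarrow>
      \<exists>d>0. \<forall>h. 0 < h \<and> h < d \<longrightarrow> norm (integral (cbox x (x + h *\<^sub>R One)) ?H /\<^sub>R h ^ DIM(real) - ?H x) < e"
    then show ?thesis by (intro exI[of _ N] conjI allI impI)
  qed
  then obtain N where N: "negligible N" and lim: "\<And>x e. x \<notin> N \<Longrightarrow> 0 < e \<Longrightarrow>
      \<exists>d>0. \<forall>h. 0 < h \<and> h < d \<longrightarrow> norm (integral (cbox x (x + h *\<^sub>R One)) ?H /\<^sub>R h ^ DIM(real) - ?H x) < e"
    by auto
  have diff: "integral {r..r + h} ?H = ball_integral f (r + h) - ball_integral f r" if "h > 0" for r h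
  proof -
    have "integral {r..r + h} ?H = (\<integral>x. indicator {r..r + h} x *\<^sub>R ?H x \<partial>lborel)"
      using set_borel_integral_eq_integral(2)[OF set[of r "r + h"]] by (simp add: set_lebesgue_integral_def)
    also have "\<dots> = (\<integral>x. indicator {..<r + h} x *\<^sub>R ?H x - indicator {..<r} x *\<^sub>R ?H x \<partial>lborel)"
    proof (rule integral_cong_AE)
      show "AE x in lborel. indicator {r..r + h} x *\<^sub>R ?H x = indicator {..<r + h} x *\<^sub>R ?H x - indicator {..<r} x *\<^sub>R ?H x"
        using AE_lborel_singleton[of "r + h"] by eventually_elim (use that in \<open>auto simp: indicator_def\<close>)
      show "(\<lambda>x. indicator {r..r + h} x *\<^sub>R ?H x) \<in> borel_measurable lborel"
        using set[of r "r + h"] unfolding set_integrable_def by (rule borel_measurable_integrable)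
    qed (intro borel_measurable_integrable Bochner_Integration.integrable_diff intH)
    also have "\<dots> = ball_integral f (r + h) - ball_integral f r"
      unfolding ballH by (intro Bochner_Integration.integral_diff intH)
    finally show ?thesis .
  qed
  have bound: "norm (ball_integral f (r + h) - ball_integral f r) \<le> sqrt (?S * (2 * a + h / r)) * l2 w * (h / r)" if "r > 0" "h > 0" for r h
  proof -
    \<comment> \<open>Chosen so that \<open>r * exp \<epsilon> = r + h\<close>.\<close>
    define \<epsilon> where "\<epsilon> = ln (1 + h / r)"
    have hr: "h / r > 0" using that by simp
    have \<epsilon>: "0 \<le> \<epsilon>" "\<epsilon> \<le> h / r"
      using hr ln_add_one_self_le_self[of "h / r"] by (auto simp: \<epsilon>_def)
    have "r * exp \<epsilon> = r + h" using that hr by (simp add: \<epsilon>_def field_simps)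
    then have "norm (ball_integral f (r + h) - ball_integral f r) \<le> sqrt (?S * (2 * a + \<epsilon>)) * l2 w * \<epsilon>"
      using ball_integral_increment[OF f _ a w gen \<epsilon>(1), of r] supp by simp
    also have "\<dots> \<le> sqrt (?S * (2 * a + h / r)) * l2 w * (h / r)"
      using \<epsilon> a by (intro mult_mono real_sqrt_le_mono mult_left_mono) auto
    finally show ?thesis .
  qed
  have main: "norm (?H r) \<le> sqrt (?S * (2 * a)) * l2 w / r" if r: "r > 0" "r \<notin> N" for r
  proof (rule field_le_epsilon)
    fix e :: real assume "e > 0"
    from lim[OF r(2) this] obtain d where d: "d > 0" "\<And>h. 0 < h \<Longrightarrow> h < d \<Longrightarrow>
      norm (integral (cbox r (r + h *\<^sub>R One)) ?H /\<^sub>R h ^ DIM(real) - ?H r) < e" by blast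
    have "norm (?H r) \<le> sqrt (?S * (2 * a + h / r)) * l2 w / r + e" if h: "0 < h" "h < d" for h
    proof -
      have D: "norm ((ball_integral f (r + h) - ball_integral f r) /\<^sub>R h - ?H r) < e"
        using d(2)[OF h] diff[OF h(1), of r] by simp
      have "norm ((ball_integral f (r + h) - ball_integral f r) /\<^sub>R h) \<le> sqrt (?S * (2 * a + h / r)) * l2 w / r"
      proof -
        have "norm ((ball_integral f (r + h) - ball_integral f r) /\<^sub>R h) = norm (ball_integral f (r + h) - ball_integral f r) / h"
          using h(1) unfolding norm_scaleR by (simp add: divide_inverse mult.commute)
        also have "\<dots> \<le> sqrt (?S * (2 * a + h / r)) * l2 w * (h / r) / h"
          using h(1) by (intro divide_right_mono bound r) auto
        also have "\<dots> = sqrt (?S * (2 * a + h / r)) * l2 w / r" using h(1) by simp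
        finally show ?thesis .
      qed
      with D show ?thesis
        using norm_triangle_ineq2[of "?H r" "(ball_integral f (r + h) - ball_integral f r) /\<^sub>R h"]
        by (simp add: norm_minus_commute)
    qed
    then have ev: "\<forall>\<^sub>F h in at_right 0. norm (?H r) \<le> sqrt (?S * (2 * a + h / r)) * l2 w / r + e"
      using d(1) by (auto simp: eventually_at_right_field)
    have "((\<lambda>h. sqrt (?S * (2 * a + h / r)) * l2 w / r + e) \<longlongrightarrow> sqrt (?S * (2 * a + 0 / r)) * l2 w / r + e) (at_right 0)"
      using r by (intro tendsto_intros) auto
    from tendsto_lowerbound[OF this ev] show "norm (?H r) \<le> sqrt (?S * (2 * a)) * l2 w / r + e" by simp
  qed
  have "AE r in lebesgue. r \<notin> N"
    using N by (simp add: AE_not_in negligible_iff_null_sets)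
  then have "AE r in lborel. r \<notin> N" by (simp add: AE_completion_iff)
  then show ?thesis by eventually_elim (use main in blast)
qed

lemma sphere_integral_bound:
  fixes f w :: "real^'n::finite \<Rightarrow> complex"
  assumes f: "sq_int f" and supp: "\<And>x. f x \<noteq> 0 \<Longrightarrow> exp (- a) \<le> norm x \<and> norm x \<le> exp a" and a: "a > 0"
    and w: "sq_int w" and gen: "dil_generator f w"
  shows "AE r in lborel. r > 0 \<longrightarrow> norm (sphere_integral f r)
    \<le> sqrt (measure (surface :: (real^'n) measure) (sphere 0 1) * (2 * a)) * l2 w * r powr (- (real CARD('n) / 2))"
proof -
  have "AE r in lborel. r > 0 \<longrightarrow>
    norm (radial_density f r) \<le> sqrt (measure (surface :: (real^'n) measure) (sphere 0 1) * (2 * a)) * l2 w / r"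
    by (rule radial_density_bound[OF f supp a w gen])
  then show ?thesis
  proof (eventually_elim, intro impI)
    fix r :: real
    let ?n = "CARD('n)" and ?B = "sqrt (measure (surface :: (real^'n) measure) (sphere 0 1) * (2 * a)) * l2 w"
    assume bd: "r > 0 \<longrightarrow> norm (radial_density f r) \<le> ?B / r" and r: "r > 0"
    have pos: "r powr (real ?n / 2) > 0" using r by simp
    let ?A = "r ^ (?n - 1)" and ?D = "r powr (- (real ?n / 2))" and ?I = "norm (sphere_integral f r)"
    have "r * ?A = r powr (real ?n)"
      using power_minus_mult[of ?n r] unfolding powr_realpow[OF r] by (simp only: mult.commute zero_less_card_finite)
    then have "r * (?A * ?D) = r powr (real ?n + - (real ?n / 2))"
      by (simp only: mult.assoc[symmetric] powr_add)
    also have "real ?n + - (real ?n / 2) = real ?n / 2" by simp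
    finally have *: "r * (?A * ?D) = r powr (real ?n / 2)" .
    have "norm (radial_density f r) = ?A * ?D * ?I"
      using r by (simp add: radial_density_def)
    then have "?I * r powr (real ?n / 2) = r * norm (radial_density f r)"
      unfolding *[symmetric] by (simp only: mult.commute mult.left_commute mult.assoc)
    also have "\<dots> \<le> ?B"
      using bd r by (simp add: pos_le_divide_eq mult.commute)
    finally have "?I * r powr (real ?n / 2) \<le> ?B" .
    then have "norm (sphere_integral f r) \<le> ?B / r powr (real ?n / 2)"
      unfolding pos_le_divide_eq[OF pos] .
    then show "norm (sphere_integral f r) \<le> ?B * r powr (- (real ?n / 2))"
      by (simp only: powr_minus divide_inverse)
  qed
qed

lemma sphere_integral_support:
  fixes f :: "real^'n::finite \<Rightarrow> complex"
  assumes "\<And>x. f x \<noteq> 0 \<Longrightarrow> c \<le> norm x \<and> norm x \<le> d" "sphere_integral f r \<noteq> 0" "r > 0"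
  shows "c \<le> r \<and> r \<le> d"
proof (rule ccontr)
  assume "\<not> (c \<le> r \<and> r \<le> d)"
  then have "f (r *\<^sub>R \<omega>) = 0" if "norm \<omega> = 1" for \<omega>
    using assms(1)[of "r *\<^sub>R \<omega>"] that \<open>r > 0\<close> by auto
  then have "sphere_integral f r = (\<integral>\<omega>. 0 \<partial>(surface :: (real^'n) measure))"
    unfolding sphere_integral_def by (intro Bochner_Integration.integral_cong refl) (auto simp: space_surface)
  with assms(2) show False by simp
qed

section \<open>The Sobolev norm of the spherical mean\<close>

text \<open>The Sobolev exponent \<open>p\<close> satisfies \<open>p - n p / 2 = - n\<close>, so the pointwise bound becomes the density
  \<open>dr / r\<close>.\<close>

lemma weighted_power_bound:
  assumes n: "n > 2" and r: "r > 0" and y: "0 \<le> y" "y \<le> B * r powr (- (real n / 2))" and B: "0 \<le> B"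
  shows "r ^ (n - 1) * (r * y) powr sobolev_exponent n \<le> B powr sobolev_exponent n * (1 / r)"
proof -
  let ?p = "sobolev_exponent n"
  have p: "?p > 0" using n by (simp add: sobolev_exponent_def)
  have n2: "real n - 2 \<noteq> 0" using n by simp
  have e: "?p - (real n / 2) * ?p = - real n"
    using n2 by (simp add: sobolev_exponent_def divide_simps) (simp add: algebra_simps)
  have "(r * y) powr ?p = r powr ?p * y powr ?p"
    using r y by (simp add: powr_mult)
  also have "\<dots> \<le> r powr ?p * (B * r powr (- (real n / 2))) powr ?p"
    using p y by (intro mult_left_mono powr_mono2) auto
  also have "(B * r powr (- (real n / 2))) powr ?p = B powr ?p * r powr (- (real n / 2) * ?p)"
    using B by (simp add: powr_mult powr_powr)
  also have "r powr ?p * (B powr ?p * r powr (- (real n / 2) * ?p)) = B powr ?p * r powr (?p - (real n / 2) * ?p)"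
    by (simp add: powr_add[symmetric] mult.left_commute)
  finally have "(r * y) powr ?p \<le> B powr ?p * r powr (- real n)" unfolding e .
  then have "r ^ (n - 1) * (r * y) powr ?p \<le> r ^ (n - 1) * (B powr ?p * r powr (- real n))"
    using r by (intro mult_left_mono) auto
  also have "\<dots> = B powr ?p * (r powr real (n - 1) * r powr (- real n))"
    using r by (simp only: powr_realpow mult.left_commute)
  also have "r powr real (n - 1) * r powr (- real n) = r powr (-1)"
    using n by (simp add: powr_add[symmetric] of_nat_diff)
  also have "r powr (-1) = 1 / r" using r by (simp add: powr_minus_divide)
  finally show ?thesis .
qed

text \<open>The annulus has measure \<open>2 a\<close> with respect to \<open>dr / r\<close>. The function \<open>m\<close> is compared with a Borel
  version \<open>m0\<close>, since a spherical mean of a Lebesgue measurable function is only determined almost everywhere.\<close>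

lemma Lp_norm_bound_from_pointwise_bound:
  fixes m :: "real \<Rightarrow> complex"
  assumes n: "n > 2" and a: "a > 0" and B: "0 \<le> B"
    and m0: "m0 \<in> borel_measurable borel" and eq: "AE r in lborel. r > 0 \<longrightarrow> m r = m0 r"
    and bound: "AE r in lborel. r > 0 \<longrightarrow> norm (m0 r) \<le> B * r powr (- (real n / 2))"
    and supp: "\<And>r. r > 0 \<Longrightarrow> m0 r \<noteq> 0 \<Longrightarrow> exp (- a) \<le> r \<and> r \<le> exp a"
  defines "p \<equiv> sobolev_exponent n"
  shows "in_Lp p (radial_measure n) (\<lambda>r. r *\<^sub>R m r)"
    and "(Lp_norm p (radial_measure n) (\<lambda>r. r *\<^sub>R m r))\<^sup>2 \<le> (2 * a) powr (2 / p) * B\<^sup>2"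
proof -
  have p: "p > 0" using n by (simp add: p_def sobolev_exponent_def)
  let ?L = "restrict_space lebesgue {0<..} :: real measure"
  let ?P = "\<lambda>r. norm (r *\<^sub>R m r) powr p"
  let ?Q = "\<lambda>r. indicator {0<..} r *\<^sub>R (r ^ (n - 1) *\<^sub>R ?P r)"
  let ?b = "\<lambda>r. B powr p * (1 / r * indicator {exp (- a)..exp a} r)"
  define h where "h r = (if r > 0 then r *\<^sub>R m r else 0)" for r
  have ae: "AE r in lborel. h r = (if r > 0 then r *\<^sub>R m0 r else 0)"
    using eq by eventually_elim (simp add: h_def)
  have "(\<lambda>r. if r > 0 then r *\<^sub>R m0 r else 0) \<in> borel_measurable lborel"
    using m0 by simp
  from borel_measurable_completion_AE[OF this ae]
  have h: "h \<in> borel_measurable lebesgue" .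
  have mL: "(\<lambda>r. r *\<^sub>R m r) \<in> borel_measurable ?L"
  proof -
    have "h \<in> borel_measurable ?L" by (rule measurable_restrict_space1[OF h])
    moreover have "h r = r *\<^sub>R m r" if "r \<in> space ?L" for r
      using that by (simp add: h_def space_restrict_space)
    ultimately show ?thesis by (subst measurable_cong[symmetric])
  qed
  have PL: "?P \<in> borel_measurable ?L"
    using measurable_compose[OF mL, of "\<lambda>z. norm z powr p" borel] by measurable
  have wL: "(\<lambda>r::real. r ^ (n - 1)) \<in> borel_measurable ?L"
    by (intro measurable_restrict_space1 measurable_completion) simp
  have w0: "AE r in ?L. 0 \<le> r ^ (n - 1)"
    by (intro AE_I2) (simp add: space_restrict_space)
  have Qb: "AE r in lborel. 0 \<le> ?Q r \<and> ?Q r \<le> ?b r"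
    using eq bound
  proof eventually_elim
    case (elim r)
    show ?case
    proof (cases "r > 0 \<and> m0 r \<noteq> 0")
      case True
      then have r: "r > 0" and supp': "r \<in> {exp (- a)..exp a}" using supp[of r] by auto
      have "r ^ (n - 1) * (r * norm (m r)) powr p \<le> B powr p * (1 / r)"
        unfolding p_def using elim r by (intro weighted_power_bound n B) auto
      then show ?thesis using r supp' by simp
    next
      case False
      then have "?Q r = 0" using elim by (cases "r > 0") auto
      moreover have "0 \<le> ?b r"
        using exp_gt_zero[of "- a"] by (auto simp: indicator_def simp del: exp_gt_zero)
      ultimately show ?thesis by (simp only: order_refl simp_thms)
    qed
  qed
  have bi: "has_bochner_integral lborel (\<lambda>r. 1 / r * indicator {exp (- a)..exp a} r) (ln (exp a) - ln (exp (- a)))"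
  proof (rule has_bochner_integral_FTC_Icc_nonneg)
    fix x assume "x \<in> {exp (- a)..exp a}"
    then have x: "x > 0" using exp_gt_zero[of "- a"] by (auto simp del: exp_gt_zero)
    then show "(ln has_real_derivative 1 / x) (at x)" by (auto intro!: derivative_eq_intros)
    show "0 \<le> 1 / x" using x by simp
  qed (use a in auto)
  have b: "integrable lborel ?b" "(\<integral>r. ?b r \<partial>lborel) = B powr p * (2 * a)"
  proof -
    have i: "integrable lborel (\<lambda>r. 1 / r * indicator {exp (- a)..exp a} r)"
      "(\<integral>r. 1 / r * indicator {exp (- a)..exp a} r \<partial>lborel) = 2 * a"
      using bi by (auto simp: has_bochner_integral_iff)
    show "integrable lborel ?b" by (rule integrable_mult_right[OF i(1)])
    show "(\<integral>r. ?b r \<partial>lborel) = B powr p * (2 * a)"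
      unfolding integral_mult_right_zero i(2) ..
  qed
  have bL: "integrable lebesgue ?b" "(\<integral>r. ?b r \<partial>lebesgue) = B powr p * (2 * a)"
    using b borel_measurable_integrable[OF b(1)]
    by (auto simp: integrable_completion integral_completion)
  have QL: "?Q \<in> borel_measurable lebesgue"
  proof -
    have "(\<lambda>r. indicator {0<..} r *\<^sub>R (r ^ (n - 1) *\<^sub>R (norm (h r) powr p))) \<in> borel_measurable lebesgue"
    proof (intro borel_measurable_scaleR)
      show "(indicator {0<..} :: real \<Rightarrow> real) \<in> borel_measurable lebesgue" "(\<lambda>r::real. r ^ (n - 1)) \<in> borel_measurable lebesgue"
        by (intro measurable_completion; simp)+
      show "(\<lambda>r. norm (h r) powr p) \<in> borel_measurable lebesgue"
        using h by measurable
    qed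
    moreover have "indicator {0<..} r *\<^sub>R (r ^ (n - 1) *\<^sub>R (norm (h r) powr p)) = ?Q r" for r
      by (simp add: h_def indicator_def)
    ultimately show ?thesis by (simp only:)
  qed
  have Qb': "AE r in lebesgue. 0 \<le> ?Q r \<and> ?Q r \<le> ?b r"
    by (rule AE_completion[OF Qb])
  have Qi: "integrable lebesgue ?Q"
  proof (rule Bochner_Integration.integrable_bound[OF bL(1) QL])
    show "AE r in lebesgue. norm (?Q r) \<le> norm (?b r)"
      using Qb' by eventually_elim (unfold real_norm_def, linarith)
  qed
  have \<Omega>: "{0<..} \<inter> space lebesgue \<in> sets (lebesgue :: real measure)" by simp
  have Pi: "integrable (radial_measure n) ?P"
    unfolding radial_measure_def integrable_density[OF PL wL w0] integrable_restrict_space[OF \<Omega>]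
    by (rule Qi)
  have "(\<integral>r. ?P r \<partial>radial_measure n) = (\<integral>r. ?Q r \<partial>lebesgue)"
    unfolding radial_measure_def integral_density[OF PL wL w0] integral_restrict_space[OF \<Omega>] ..
  also have "\<dots> \<le> (\<integral>r. ?b r \<partial>lebesgue)"
    by (rule integral_mono_AE[OF Qi bL(1)]) (use Qb' in \<open>eventually_elim, simp only:\<close>)
  finally have le: "(\<integral>r. ?P r \<partial>radial_measure n) \<le> B powr p * (2 * a)" by (simp only: bL)
  show "in_Lp p (radial_measure n) (\<lambda>r. r *\<^sub>R m r)"
    unfolding in_Lp_def using Pi mL by (auto simp: radial_measure_def)
  have nn: "0 \<le> (\<integral>r. ?P r \<partial>radial_measure n)"
    by (intro Bochner_Integration.integral_nonneg) simp
  have "(Lp_norm p (radial_measure n) (\<lambda>r. r *\<^sub>R m r))\<^sup>2 = (\<integral>r. ?P r \<partial>radial_measure n) powr (2 / p)"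
    by (simp add: Lp_norm_def power2_eq_square powr_add[symmetric])
  also have "\<dots> \<le> (B powr p * (2 * a)) powr (2 / p)"
    using p by (intro powr_mono2 nn le) auto
  also have "\<dots> = (2 * a) powr (2 / p) * B powr 2"
    using p a by (simp add: powr_mult powr_powr)
  also have "B powr 2 = B\<^sup>2" using B by (simp add: powr_numeral)
  finally show "(Lp_norm p (radial_measure n) (\<lambda>r. r *\<^sub>R m r))\<^sup>2 \<le> (2 * a) powr (2 / p) * B\<^sup>2" .
qed

section \<open>Reduction to Borel functions and conclusion\<close>

lemma ex_borel_version:
  fixes f :: "'a::euclidean_space \<Rightarrow> complex"
  assumes "f \<in> borel_measurable lebesgue"
  obtains f0 where "f0 \<in> borel_measurable borel" "AE x in lborel. f x = f0 x"
proof -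
  have "(\<lambda>x. Re (f x)) \<in> borel_measurable lebesgue" "(\<lambda>x. Im (f x)) \<in> borel_measurable lebesgue"
    using assms by (auto intro: measurable_compose[OF _ borel_measurable_continuous_onI[OF linear_continuous_on[OF bounded_linear_Re]]]
        measurable_compose[OF _ borel_measurable_continuous_onI[OF linear_continuous_on[OF bounded_linear_Im]]])
  from this[THEN completion_ex_borel_measurable_real]
  obtain u v where [measurable]: "u \<in> borel_measurable borel" "v \<in> borel_measurable borel"
    and ae: "AE x in lborel. Re (f x) = u x" "AE x in lborel. Im (f x) = v x" by auto
  show ?thesis
  proof (rule that)
    show "(\<lambda>x. of_real (u x) + \<i> * of_real (v x)) \<in> borel_measurable borel" by measurable
    show "AE x in lborel. f x = of_real (u x) + \<i> * of_real (v x)"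
      using ae by eventually_elim (simp add: complex_eq_iff)
  qed
qed

text \<open>Distributional derivatives do not depend on the chosen version of the functions.\<close>

lemma is_Lf_cong_AE:
  fixes f f0 g g0 :: "real^'n::finite \<Rightarrow> complex"
  assumes m: "f \<in> borel_measurable lebesgue" "g \<in> borel_measurable lebesgue"
      "f0 \<in> borel_measurable borel" "g0 \<in> borel_measurable borel"
    and ae: "AE x in lborel. f x = f0 x" "AE x in lborel. g x = g0 x"
    and "is_Lf f g"
  shows "is_Lf f0 g0"
proof -
  have reg: "regular_dist u \<psi> = regular_dist u0 \<psi>"
    if "u \<in> borel_measurable lebesgue" "u0 \<in> borel_measurable borel" "AE x in lborel. u x = u0 x" "continuous_on UNIV \<psi>"
    for u u0 \<psi> :: "real^'n \<Rightarrow> complex"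
  proof -
    have "\<psi> \<in> borel_measurable lebesgue" "u0 \<in> borel_measurable lebesgue"
      using that by (auto intro!: measurable_completion borel_measurable_continuous_onI)
    moreover have "AE x in lebesgue. u x * \<psi> x = u0 x * \<psi> x"
      using AE_completion[OF that(3)] by eventually_elim simp
    ultimately show ?thesis
      unfolding regular_dist_def using that(1) by (intro integral_cong_AE borel_measurable_times)
  qed
  show ?thesis
    unfolding is_Lf_def
  proof (intro allI impI)
    fix \<phi> :: "real^'n \<Rightarrow> complex" assume \<phi>: "test_function \<phi>"
    have c: "continuous_on UNIV (partial_deriv j (\<lambda>x. of_real (x $ j) * \<phi> x))" for j
    proof -
      have "continuous_on UNIV (\<lambda>x. \<phi> x + of_real (x $ j) * partial_deriv j \<phi> x)"
        by (intro continuous_intros test_function_continuous test_function_partial \<phi>)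
      moreover have "partial_deriv j (\<lambda>x. of_real (x $ j) * \<phi> x) = (\<lambda>x. \<phi> x + of_real (x $ j) * partial_deriv j \<phi> x)"
        by (intro ext partial_deriv_coordinate_mult \<phi>)
      ultimately show ?thesis by simp
    qed
    have "dist_L (regular_dist f0) \<phi> = dist_L (regular_dist f) \<phi>"
      by (simp add: dist_L_def dist_mult_def dist_partial_def reg[OF m(1,3) ae(1) c])
    also have "\<dots> = regular_dist g \<phi>" using \<open>is_Lf f g\<close> \<phi> by (simp add: is_Lf_def)
    also have "\<dots> = regular_dist g0 \<phi>"
      by (rule reg[OF m(2,4) ae(2) test_function_continuous[OF \<phi>]])
    finally show "dist_L (regular_dist f0) \<phi> = regular_dist g0 \<phi>" .
  qed
qed

lemma in_Lp_borel_version: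
  fixes f f0 :: "'a::euclidean_space \<Rightarrow> complex"
  assumes f: "in_Lp 2 lebesgue f" and m: "f0 \<in> borel_measurable borel" and ae: "AE x in lborel. f x = f0 x"
  shows "sq_int f0" and "(Lp_norm 2 lebesgue f)\<^sup>2 = (l2 f0)\<^sup>2"
proof -
  have i: "integrable lebesgue (\<lambda>x. (norm (f x))\<^sup>2)" using f by (simp add: in_Lp_def)
  have ae': "AE x in lebesgue. (norm (f x))\<^sup>2 = (norm (f0 x))\<^sup>2"
    using AE_completion[OF ae] by eventually_elim simp
  have m2: "(\<lambda>x. (norm (f0 x))\<^sup>2) \<in> borel_measurable borel" using m by measurable
  have "integrable lebesgue (\<lambda>x. (norm (f0 x))\<^sup>2)"
    by (rule integrable_cong_AE_imp[OF i _ ae']) (use m2 in \<open>auto intro: measurable_completion\<close>)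
  then have "integrable lborel (\<lambda>x. (norm (f0 x))\<^sup>2)" using m2 by (simp add: integrable_completion)
  with m show "sq_int f0" by (simp add: sq_int_def)
  have "(\<integral>x. (norm (f x))\<^sup>2 \<partial>lebesgue) = (\<integral>x. (norm (f0 x))\<^sup>2 \<partial>lebesgue)"
    using i m2 by (intro integral_cong_AE ae') (auto intro: measurable_completion)
  also have "\<dots> = (l2 f0)\<^sup>2" using m2 by (simp add: l2_square integral_completion)
  finally have "(\<integral>x. (norm (f x))\<^sup>2 \<partial>lebesgue) = (l2 f0)\<^sup>2" .
  then show "(Lp_norm 2 lebesgue f)\<^sup>2 = (l2 f0)\<^sup>2"
    by (simp add: Lp_norm_def powr_half_sqrt)
qed

theorem corollary6:
  assumes "CARD('n::finite) > 2"
  shows "\<exists>C::real. C > 0 \<and>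
    (\<forall>R::real. R > 1 \<longrightarrow>
      (\<forall>f g :: real^'n \<Rightarrow> complex.
         in_Lp 2 lebesgue f \<longrightarrow> in_Lp 2 lebesgue g \<longrightarrow> is_Lf f g \<longrightarrow>
         (AE x in lebesgue. \<not> (1 / R \<le> norm x \<and> norm x \<le> R) \<longrightarrow> f x = 0) \<longrightarrow>
         in_Lp (sobolev_exponent CARD('n)) (radial_measure CARD('n))
           (\<lambda>r. r *\<^sub>R spherical_mean f r) \<and>
         (Lp_norm (sobolev_exponent CARD('n)) (radial_measure CARD('n))
            (\<lambda>r. r *\<^sub>R spherical_mean f r))\<^sup>2
         \<le> C * ln R powr (2 * (real CARD('n) - 1) / real CARD('n)) *
             ((Lp_norm 2 lebesgue g)\<^sup>2 - (real CARD('n))\<^sup>2 / 4 * (Lp_norm 2 lebesgue f)\<^sup>2)))"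
proof -
  let ?n = "real CARD('n)"
  let ?S = "measure (surface :: (real^'n) measure) (sphere 0 1)"
  let ?q = "2 * (?n - 1) / ?n"
  have S: "?S > 0" by (rule measure_surface_pos)
  show ?thesis
  proof (intro exI[of _ "2 powr ?q / ?S"] conjI allI impI)
    show "2 powr ?q / ?S > 0" using S by simp
    fix R :: real and f g :: "real^'n \<Rightarrow> complex"
    assume R: "R > 1" and f: "in_Lp 2 lebesgue f" and g: "in_Lp 2 lebesgue g" and Lf: "is_Lf f g"
      and supp: "AE x in lebesgue. \<not> (1 / R \<le> norm x \<and> norm x \<le> R) \<longrightarrow> f x = 0"
    define a where "a = ln R"
    have a: "a > 0" "exp a = R" "exp (- a) = 1 / R"
      using R by (auto simp: a_def exp_minus divide_inverse)
    have mf: "f \<in> borel_measurable lebesgue" and mg: "g \<in> borel_measurable lebesgue"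
      using f g by (auto simp: in_Lp_def)
    obtain f1 where f1: "f1 \<in> borel_measurable borel" "AE x in lborel. f x = f1 x"
      by (rule ex_borel_version[OF mf])
    obtain g0 where g0: "g0 \<in> borel_measurable borel" "AE x in lborel. g x = g0 x"
      by (rule ex_borel_version[OF mg])
    \<comment> \<open>A Borel version that vanishes everywhere, not only almost everywhere, outside the annulus.\<close>
    define f0 where "f0 x = (if exp (- a) \<le> norm x \<and> norm x \<le> exp a then f1 x else 0)" for x
    have f0: "f0 \<in> borel_measurable borel"
      using f1(1) unfolding f0_def[abs_def] by measurable
    have ff0: "AE x in lborel. f x = f0 x"
      using f1(2) supp[unfolded AE_completion_iff] by eventually_elim (auto simp: f0_def a)
    have supp0: "exp (- a) \<le> norm x \<and> norm x \<le> exp a" if "f0 x \<noteq> 0" for x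
      using that by (auto simp: f0_def split: if_splits)
    have sf: "sq_int f0" and nf: "(Lp_norm 2 lebesgue f)\<^sup>2 = (l2 f0)\<^sup>2"
      using in_Lp_borel_version[OF f f0 ff0] by auto
    have sg: "sq_int g0" and ng: "(Lp_norm 2 lebesgue g)\<^sup>2 = (l2 g0)\<^sup>2"
      using in_Lp_borel_version[OF g g0] by auto
    have Lf0: "is_Lf f0 g0"
      by (rule is_Lf_cong_AE[OF mf mg f0 g0(1) ff0 g0(2) Lf])
    define w where "w x = g0 x + of_nat CARD('n) / 2 * f0 x" for x
    have w: "sq_int w"
      unfolding w_def[abs_def] by (intro sq_int_add sq_int_cmult sf sg)
    have gen: "dil_generator f0 w"
      unfolding w_def[abs_def] by (rule is_Lf_imp_dil_generator[OF sf sg Lf0])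
    have "f0 x = 0" if "norm x > exp a" for x using that by (simp add: f0_def)
    then have lw: "(l2 w)\<^sup>2 = (l2 g0)\<^sup>2 - ?n\<^sup>2 / 4 * (l2 f0)\<^sup>2"
      unfolding w_def[abs_def] by (rule l2_generator_square[OF sf _ sg Lf0])
    define B where "B = sqrt (?S * (2 * a)) * l2 w / ?S"
    have B: "0 \<le> B" using S a by (simp add: B_def)
    let ?m0 = "\<lambda>r. sphere_integral f0 r /\<^sub>R ?S"
    have m0: "?m0 \<in> borel_measurable borel" using sphere_integral_measurable[OF f0] by measurable
    have "AE r in lborel. r > 0 \<longrightarrow> norm (sphere_integral f0 r)
        \<le> sqrt (?S * (2 * a)) * l2 w * r powr (- (?n / 2))"
      by (rule sphere_integral_bound[OF sf supp0 a(1) w gen])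
    then have bound: "AE r in lborel. r > 0 \<longrightarrow> norm (?m0 r) \<le> B * r powr (- (?n / 2))"
    proof eventually_elim
      case (elim r)
      show ?case
      proof
        assume "r > 0"
        with elim have "inverse ?S * norm (sphere_integral f0 r) \<le> inverse ?S * (sqrt (?S * (2 * a)) * l2 w * r powr (- (?n / 2)))"
          using S by (intro mult_left_mono) auto
        also have "\<dots> = B * r powr (- (?n / 2))" by (simp only: B_def divide_inverse mult.commute mult.left_commute)
        finally show "norm (?m0 r) \<le> B * r powr (- (?n / 2))" using S by simp
      qed
    qed
    have suppm: "exp (- a) \<le> r \<and> r \<le> exp a" if "r > 0" "?m0 r \<noteq> 0" for r
    proof -
      have "sphere_integral f0 r \<noteq> 0" using that(2) by auto
      show ?thesis by (rule sphere_integral_support[OF supp0 \<open>sphere_integral f0 r \<noteq> 0\<close> that(1)])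
    qed
    let ?p = "sobolev_exponent CARD('n)"
    note result = Lp_norm_bound_from_pointwise_bound[OF assms a(1) B m0 spherical_mean_AE[OF f0 ff0] bound suppm]
    show "in_Lp ?p (radial_measure CARD('n)) (\<lambda>r. r *\<^sub>R spherical_mean f r)"
      by (rule result(1))
    have "(Lp_norm ?p (radial_measure CARD('n)) (\<lambda>r. r *\<^sub>R spherical_mean f r))\<^sup>2 \<le> (2 * a) powr (2 / ?p) * B\<^sup>2"
      by (rule result(2))
    also have "B\<^sup>2 = (2 * a) * (l2 w)\<^sup>2 / ?S"
    proof -
      have "(sqrt (?S * (2 * a)))\<^sup>2 = ?S * (2 * a)" using S a(1) by (intro real_sqrt_pow2) simp
      then have "B\<^sup>2 = ?S * (2 * a) * (l2 w)\<^sup>2 / ?S\<^sup>2"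
        unfolding B_def power_divide power_mult_distrib by (simp only:)
      then show ?thesis using S by (simp add: power2_eq_square)
    qed
    also have "(2 * a) powr (2 / ?p) * ((2 * a) * (l2 w)\<^sup>2 / ?S) = (2 * a) powr (2 / ?p + 1) * (l2 w)\<^sup>2 / ?S"
      using a(1) by (simp add: powr_add)
    also have "2 / ?p + 1 = ?q"
      using assms by (simp add: sobolev_exponent_def field_simps)
    also have "(2 * a) powr ?q = 2 powr ?q * a powr ?q"
      using a(1) by (simp add: powr_mult)
    finally show "(Lp_norm ?p (radial_measure CARD('n)) (\<lambda>r. r *\<^sub>R spherical_mean f r))\<^sup>2
         \<le> 2 powr ?q / ?S * ln R powr ?q *
             ((Lp_norm 2 lebesgue g)\<^sup>2 - ?n\<^sup>2 / 4 * (Lp_norm 2 lebesgue f)\<^sup>2)"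
      unfolding nf ng lw[symmetric] a_def[symmetric] by (simp only: times_divide_eq_left)
  qed
qed

end
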